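(* Let $(\star)$ be a linear system over $\mathbb{F}_q$ with coefficient matrix $A=(a_{ij})\in\mathbb{F}_q^{m\times k}$ which is of type (RC), non-degenerate and irreducible. Suppose there is a partition $[k]=P_1\cup\dots\cup P_{2s}$ such that: (i) for every $r\in[s]$, the columns of $A$ indexed by $P_r\cup P_{s+r}$ sum to the zero vector; (ii) for every nonzero linear combination $(b_1,\dots,b_k)$ of the rows of $A$, one has $\sum_{j\in P_r}b_j\ne0$ for at least two different values of $r\in[s]$; (iii) for every column equivalence class $C$ of size $2$ that sums to zero, there is some $r\in[s]$ with $C=P_r\cup P_{s+r}$. Then $(\star)$ is moderate.
   Context: Solutions of $(\star)$ are tuples $(x_1,\dots,x_k)\in(\mathbb{F}_q^n)^k$ with $\sum_j a_{ij}x_j=0$ for all $i$. The system is balanced if each row of $A$ sums to $0$. A $(\star)$-shape is a solution with pairwise distinct entries. Moderate: there exist $\beta,\gamma>0$ with $\gamma<q$ such that for every $n$ every $S\subseteq\mathbb{F}_q^n$ with $|S|\ge\beta\gamma^n$ contains a $(\star)$-shape in $S^k$. Indices $j,j'$ are equivalent if columns $j,j'$ of $A$ are nonzero scalar multiples of one another; the classes are the column equivalence classes; a class sums to zero if its columns add up to zero. Type (RC): balanced with at most one column equivalence class of size $1$. Non-degenerate: rows of $A$ linearly independent and no zero column. Two systems are equivalent if each equation of one is a linear combination of those of the other. Reducible: equivalent to a system whose variables can be partitioned into at least two classes with each equation only using variables of one class; otherwise irreducible. *)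

theory Defs
  imports Complex_Main "HOL-Library.Cardinality"
begin

text \<open>Conventions. The field F_q is a finite field type 'a (q = CARD('a)).
  A vector of F_q^n is a function nat => 'a vanishing outside {..<n}.
  A linear system with coefficient matrix A in F_q^(m x k) is given by
  A :: nat => nat => 'a together with m and k (entries a_ij with i<m, j<k).
  A tuple (x_1,...,x_k) is a function x :: nat => (nat => 'a), used on {..<k}.\<close>

definition vecs :: "nat \<Rightarrow> (nat \<Rightarrow> 'a::zero) set" where
  "vecs n = {v. \<forall>i. n \<le> i \<longrightarrow> v i = 0}"

definition is_solution ::
  "nat \<Rightarrow> nat \<Rightarrow> (nat \<Rightarrow> nat \<Rightarrow> 'a::field) \<Rightarrow> (nat \<Rightarrow> nat \<Rightarrow> 'a) \<Rightarrow> bool" where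
  "is_solution m k A x \<longleftrightarrow> (\<forall>i<m. (\<lambda>t. \<Sum>j<k. A i j * x j t) = (\<lambda>t. 0))"

definition is_shape ::
  "nat \<Rightarrow> nat \<Rightarrow> (nat \<Rightarrow> nat \<Rightarrow> 'a::field) \<Rightarrow> (nat \<Rightarrow> nat \<Rightarrow> 'a) \<Rightarrow> bool" where
  "is_shape m k A x \<longleftrightarrow> is_solution m k A x \<and> inj_on x {..<k}"

definition moderate :: "nat \<Rightarrow> nat \<Rightarrow> (nat \<Rightarrow> nat \<Rightarrow> 'a::{field,finite}) \<Rightarrow> bool" where
  "moderate m k A \<longleftrightarrow>
     (\<exists>\<beta> \<gamma>::real. \<beta> > 0 \<and> \<gamma> > 0 \<and> \<gamma> < real CARD('a) \<and>
        (\<forall>n. \<forall>S. S \<subseteq> vecs n \<and> real (card S) \<ge> \<beta> * \<gamma> ^ n \<longrightarrow>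
            (\<exists>x. (\<forall>j<k. x j \<in> S) \<and> is_shape m k A x)))"

definition balanced :: "nat \<Rightarrow> nat \<Rightarrow> (nat \<Rightarrow> nat \<Rightarrow> 'a::field) \<Rightarrow> bool" where
  "balanced m k A \<longleftrightarrow> (\<forall>i<m. (\<Sum>j<k. A i j) = 0)"

definition col_equiv :: "nat \<Rightarrow> (nat \<Rightarrow> nat \<Rightarrow> 'a::field) \<Rightarrow> nat \<Rightarrow> nat \<Rightarrow> bool" where
  "col_equiv m A j j' \<longleftrightarrow> (\<exists>c. c \<noteq> 0 \<and> (\<forall>i<m. A i j = c * A i j'))"

definition col_class :: "nat \<Rightarrow> nat \<Rightarrow> (nat \<Rightarrow> nat \<Rightarrow> 'a::field) \<Rightarrow> nat \<Rightarrow> nat set" where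
  "col_class m k A j = {j'. j' < k \<and> col_equiv m A j j'}"

definition col_classes :: "nat \<Rightarrow> nat \<Rightarrow> (nat \<Rightarrow> nat \<Rightarrow> 'a::field) \<Rightarrow> nat set set" where
  "col_classes m k A = col_class m k A ` {..<k}"

definition class_sums_zero :: "nat \<Rightarrow> (nat \<Rightarrow> nat \<Rightarrow> 'a::field) \<Rightarrow> nat set \<Rightarrow> bool" where
  "class_sums_zero m A C \<longleftrightarrow> (\<forall>i<m. (\<Sum>j\<in>C. A i j) = 0)"

definition type_RC :: "nat \<Rightarrow> nat \<Rightarrow> (nat \<Rightarrow> nat \<Rightarrow> 'a::field) \<Rightarrow> bool" where
  "type_RC m k A \<longleftrightarrow> balanced m k A \<and> card {C \<in> col_classes m k A. card C = 1} \<le> 1"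

definition non_degenerate :: "nat \<Rightarrow> nat \<Rightarrow> (nat \<Rightarrow> nat \<Rightarrow> 'a::field) \<Rightarrow> bool" where
  "non_degenerate m k A \<longleftrightarrow>
     (\<forall>c. (\<forall>j<k. (\<Sum>i<m. c i * A i j) = 0) \<longrightarrow> (\<forall>i<m. c i = 0)) \<and>
     (\<forall>j<k. \<exists>i<m. A i j \<noteq> 0)"

definition in_row_span :: "nat \<Rightarrow> nat \<Rightarrow> (nat \<Rightarrow> nat \<Rightarrow> 'a::field) \<Rightarrow> (nat \<Rightarrow> 'a) \<Rightarrow> bool" where
  "in_row_span m k A b \<longleftrightarrow> (\<exists>c. \<forall>j<k. b j = (\<Sum>i<m. c i * A i j))"

definition equiv_systems ::
  "nat \<Rightarrow> nat \<Rightarrow> (nat \<Rightarrow> nat \<Rightarrow> 'a::field) \<Rightarrow> nat \<Rightarrow> (nat \<Rightarrow> nat \<Rightarrow> 'a) \<Rightarrow> bool" where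
  "equiv_systems k m A m' B \<longleftrightarrow>
     (\<forall>i<m'. in_row_span m k A (B i)) \<and> (\<forall>i<m. in_row_span m' k B (A i))"

definition reducible :: "nat \<Rightarrow> nat \<Rightarrow> (nat \<Rightarrow> nat \<Rightarrow> 'a::field) \<Rightarrow> bool" where
  "reducible m k A \<longleftrightarrow>
     (\<exists>m' B (p::nat \<Rightarrow> nat). equiv_systems k m A m' B \<and>
        card (p ` {..<k}) \<ge> 2 \<and>
        (\<forall>i<m'. \<exists>c. \<forall>j<k. B i j \<noteq> 0 \<longrightarrow> p j = c))"

definition irreducible_sys :: "nat \<Rightarrow> nat \<Rightarrow> (nat \<Rightarrow> nat \<Rightarrow> 'a::field) \<Rightarrow> bool" where
  "irreducible_sys m k A \<longleftrightarrow> \<not> reducible m k A"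

end

(* Write column j of a column class C as c j times a vector a C depending only on the class. Then x is a solution
   as soon as the class values v C = sum of c j * x j over j in C satisfy: the sum of v C * a C over all C is 0. Setting
   all variables in P r equal to y r gives, by (i), a system of the form "sum over r <= s of B r * (y r - y (s + r)) = 0".
   By (ii) no combination of its rows is supported on two variables, so a Cauchy-Schwarz count in a dense set S
   shows that most of its many solutions have distinct entries, and it remains to represent every class value v C
   in many ways by distinct vectors of S. If v C, as a linear form in y, is independent of the system up to a multiple
   of one variable, counting provides many further solutions z with the same class value, and each z r is then split up
   over the columns of C in P r. Otherwise v C is a multiple of a single y r, or 0, and it is represented through one
   balanced linear equation in at least three variables, which reduces to the slice rank method; (iii) excludes
   exactly the case of only two variables. The only class that may consist of a single column keeps its value y r. *)
theory Submission
  imports Defs "HOL-Library.FuncSet" "HOL-Analysis.Convex"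
begin

text \<open>The obstacle is distinctness across classes: each class value must be represented while
  avoiding boundedly many vectors already in use, and a bare existence result such as the slice rank
  bound does not offer this. Hence representations are required to survive the deletion of any
  \<open>N\<close> vectors. Such robustness comes for free for most vectors: if the vectors failing
  it had positive proportion in \<open>S\<close>, they would contain a subset, again of positive
  proportion, in which the obstruction of one vector never meets another vector, and solvability
  inside that subset would give a contradiction. So the variables \<open>y r\<close> are chosen in
  the part \<open>T\<close> of \<open>S\<close> that is robust for all relevant coefficient sets at
  once, while the vectors of the shape are taken from \<open>S\<close>. All this needs solvability
  in every subset of constant proportion, not only in \<open>S\<close>; that is why each step is
  stated for all sets above some threshold with base below \<open>q\<close>. Slice rank handles
  three variables; longer equations are shortened by merging several variables into one robust
  vector.\<close>

lemma card_field_gt_1: "1 < CARD('a::{field,finite})"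
proof -
  have "card {0, 1::'a} \<le> CARD('a)" by (intro card_mono) auto
  thus ?thesis by simp
qed

lemma bij_betw_vecs: "bij_betw (\<lambda>v. restrict v {..<n}) (vecs n) ({..<n} \<rightarrow>\<^sub>E (UNIV::'a::zero set))"
proof (rule bij_betw_byWitness[where f' = "\<lambda>g i. if i < n then g i else 0"])
  show "\<forall>v\<in>vecs n. (\<lambda>i. if i < n then restrict v {..<n} i else 0) = v"
    by (auto simp: vecs_def fun_eq_iff)
  show "\<forall>g\<in>{..<n} \<rightarrow>\<^sub>E (UNIV::'a set). restrict (\<lambda>i. if i < n then g i else 0) {..<n} = g"
    by (intro ballI extensionalityI[of _ "{..<n}"]) (auto simp: PiE_def)
  show "(\<lambda>v. restrict v {..<n}) ` vecs n \<subseteq> {..<n} \<rightarrow>\<^sub>E (UNIV::'a set)"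
    by (intro image_subsetI restrict_PiE_iff[THEN iffD2]) simp
  show "(\<lambda>g i. if i < n then g i else 0) ` ({..<n} \<rightarrow>\<^sub>E (UNIV::'a set)) \<subseteq> vecs n"
    by (intro image_subsetI) (simp add: vecs_def)
qed

lemma card_vecs: "card (vecs n :: (nat \<Rightarrow> 'a::{zero,finite}) set) = CARD('a) ^ n"
  using bij_betw_same_card[OF bij_betw_vecs[where 'a='a and n=n]] by (simp add: card_PiE)

lemma finite_vecs: "finite (vecs n :: (nat \<Rightarrow> 'a::{zero,finite}) set)"
  using bij_betw_finite[OF bij_betw_vecs[where 'a='a and n=n]] by (simp add: finite_PiE)

subsection \<open>Properties of exponentially dense sets\<close>

text \<open>The quantifier pattern of \<open>moderate\<close> with an arbitrary property in place of
  the existence of a shape, so that the thresholds of finitely many properties can be merged into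
  one.\<close>

definition for_dense :: "(nat \<Rightarrow> (nat \<Rightarrow> 'a::{field,finite}) set \<Rightarrow> bool) \<Rightarrow> bool" where
  "for_dense Q \<longleftrightarrow> (\<exists>\<beta> \<gamma>::real. \<beta> > 0 \<and> \<gamma> > 0 \<and> \<gamma> < real CARD('a) \<and>
     (\<forall>n S. S \<subseteq> vecs n \<longrightarrow> real (card S) \<ge> \<beta> * \<gamma> ^ n \<longrightarrow> Q n S))"

lemma for_denseI:
  fixes Q :: "nat \<Rightarrow> (nat \<Rightarrow> 'a::{field,finite}) set \<Rightarrow> bool"
  assumes "\<beta> > 0" "\<gamma> > 0" "\<gamma> < real CARD('a)"
    "\<And>n S. S \<subseteq> vecs n \<Longrightarrow> real (card S) \<ge> \<beta> * \<gamma> ^ n \<Longrightarrow> Q n S"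
  shows "for_dense Q"
  using assms unfolding for_dense_def by blast

lemma for_denseE:
  fixes Q :: "nat \<Rightarrow> (nat \<Rightarrow> 'a::{field,finite}) set \<Rightarrow> bool"
  assumes "for_dense Q"
  obtains \<beta> \<gamma> where "\<beta> > 0" "\<gamma> > 0" "\<gamma> < real CARD('a)"
    "\<And>n S. S \<subseteq> vecs n \<Longrightarrow> real (card S) \<ge> \<beta> * \<gamma> ^ n \<Longrightarrow> Q n S"
  using assms unfolding for_dense_def by blast

lemma for_dense_mono:
  assumes "for_dense P" "\<And>n S. S \<subseteq> vecs n \<Longrightarrow> P n S \<Longrightarrow> Q n S"
  shows "for_dense Q"
  using assms unfolding for_dense_def by meson

lemma for_dense_True:
  assumes "\<And>n S. S \<subseteq> vecs n \<Longrightarrow> Q n (S :: (nat \<Rightarrow> 'a::{field,finite}) set)"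
  shows "for_dense Q"
  using assms card_field_gt_1[where 'a='a] by (intro for_denseI[of 1 1]) auto

lemma for_dense_conj:
  fixes P Q :: "nat \<Rightarrow> (nat \<Rightarrow> 'a::{field,finite}) set \<Rightarrow> bool"
  assumes "for_dense P" "for_dense Q"
  shows "for_dense (\<lambda>n S. P n S \<and> Q n S)"
proof -
  obtain b g where 1: "b > 0" "g > 0" "g < real CARD('a)"
    "\<And>n S. S \<subseteq> vecs n \<Longrightarrow> real (card S) \<ge> b * g ^ n \<Longrightarrow> P n S"
    using assms(1) by (elim for_denseE) blast
  obtain b' g' where 2: "b' > 0" "g' > 0" "g' < real CARD('a)"
    "\<And>n S. S \<subseteq> vecs n \<Longrightarrow> real (card S) \<ge> b' * g' ^ n \<Longrightarrow> Q n S"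
    using assms(2) by (elim for_denseE) blast
  have "b * g ^ n \<le> max b b' * max g g' ^ n" "b' * g' ^ n \<le> max b b' * max g g' ^ n" for n
    using 1 2 by (auto intro!: mult_mono power_mono)
  hence "P n S \<and> Q n S" if "S \<subseteq> vecs n" "max b b' * max g g' ^ n \<le> real (card S)" for n S
    using 1(4)[of S n] 2(4)[of S n] that order_trans by blast
  thus ?thesis
    using 1(1-3) 2(1-3) by (intro for_denseI[of "max b b'" "max g g'"]) auto
qed

lemma for_dense_ball:
  assumes "finite E" "\<And>e. e \<in> E \<Longrightarrow> for_dense (Q e)"
  shows "for_dense (\<lambda>n S. \<forall>e\<in>E. Q e n S)"
  using assms
proof (induction E)
  case empty
  show ?case by (rule for_dense_True) simp
next
  case (insert e E)
  have "for_dense (\<lambda>n S. Q e n S \<and> (\<forall>e\<in>E. Q e n S))"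
    using insert by (intro for_dense_conj) auto
  thus ?case by simp
qed

text \<open>Restricting to a subset of proportion \<open>1 / K\<close> changes the constant factor
  of the threshold and leaves its base alone.\<close>

lemma for_dense_subset:
  fixes Q :: "nat \<Rightarrow> (nat \<Rightarrow> 'a::{field,finite}) set \<Rightarrow> bool"
  assumes "for_dense Q" "K > 0"
  shows "for_dense (\<lambda>n S. \<forall>T\<subseteq>S. real (card S) \<le> K * real (card T) \<longrightarrow> Q n T)"
proof -
  obtain b g where 1: "b > 0" "g > 0" "g < real CARD('a)"
    "\<And>n S. S \<subseteq> vecs n \<Longrightarrow> real (card S) \<ge> b * g ^ n \<Longrightarrow> Q n S"
    using assms(1) by (elim for_denseE) blast
  have "Q n T" if "S \<subseteq> vecs n" "T \<subseteq> S" "real (card S) \<ge> K * b * g ^ n" "real (card S) \<le> K * real (card T)" for n S T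
  proof -
    have "K * (b * g ^ n) \<le> K * real (card T)" using that by simp
    thus ?thesis using that 1(4)[of T n] assms(2) by auto
  qed
  thus ?thesis
    using 1 assms(2) by (intro for_denseI[of "K * b" g]) auto
qed

text \<open>The base \<open>g\<close> solves \<open>g ^ Suc p = q ^ p\<close> and is therefore below
  \<open>q\<close>; the constant \<open>C\<close> is absorbed by the factor \<open>b\<close>. This
  is how density enters the counting: an estimate succeeds as soon as \<open>card S\<close> occurs
  with one more power than \<open>q ^ n\<close>.\<close>

lemma for_dense_power_card:
  "for_dense (\<lambda>n S :: (nat \<Rightarrow> 'a::{field,finite}) set. C * real CARD('a) ^ (p * n) < real (card S) ^ Suc p)"
proof -
  define q where "q = real CARD('a)"
  have q: "q > 1" using card_field_gt_1[where 'a='a] by (simp add: q_def)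
  define g where "g = root (Suc p) (q ^ p)"
  have g0: "g > 0" using q by (simp add: g_def)
  have gp: "g ^ Suc p = q ^ p" unfolding g_def using q by (intro real_root_pow_pos2) auto
  have "g < q"
  proof (rule ccontr)
    assume "\<not> g < q"
    hence "q ^ Suc p \<le> g ^ Suc p" using q by (intro power_mono) auto
    moreover have "q ^ p < q ^ Suc p" using q by simp
    ultimately show False using gp by simp
  qed
  define b where "b = 1 + \<bar>C\<bar>"
  have b: "b \<ge> 1" by (simp add: b_def)
  have "C * q ^ (p * n) < real (card S) ^ Suc p" if "real (card S) \<ge> b * g ^ n" for n and S :: "(nat \<Rightarrow> 'a) set"
  proof -
    have "C < b" by (simp add: b_def)
    also have "b \<le> b ^ Suc p" using b by (simp add: self_le_power)
    finally have "C * q ^ (p * n) < b ^ Suc p * q ^ (p * n)" using q by simp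
    also have "\<dots> = (b * g ^ n) ^ Suc p"
    proof -
      have "(g ^ n) ^ Suc p = (g ^ Suc p) ^ n" by (metis power_mult mult.commute)
      thus ?thesis unfolding power_mult_distrib gp by (simp add: power_mult)
    qed
    also have "\<dots> \<le> real (card S) ^ Suc p" using that b g0 by (intro power_mono) auto
    finally show ?thesis .
  qed
  thus ?thesis
    using b g0 \<open>g < q\<close> by (intro for_denseI[of b g]) (auto simp: q_def)
qed

lemma for_dense_card: "for_dense (\<lambda>n S :: (nat \<Rightarrow> 'a::{field,finite}) set. N \<le> card S)"
  using for_dense_power_card[where C="real N" and p=0 and 'a='a] by (rule for_dense_mono) auto

subsection \<open>Slice rank\<close>

text \<open>Over a finite field, the nontrivial solution of an underdetermined homogeneous system comes from the pigeonhole principle.\<close>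

lemma underdetermined_system:
  fixes u :: "'k \<Rightarrow> 'b \<Rightarrow> 'a::{field,finite}"
  assumes "finite S" "finite M" "card M < card S"
  shows "\<exists>g. (\<exists>x\<in>S. g x \<noteq> 0) \<and> (\<forall>x. x \<notin> S \<longrightarrow> g x = 0) \<and> (\<forall>k\<in>M. (\<Sum>x\<in>S. g x * u k x) = 0)"
proof -
  define \<phi> where "\<phi> = (\<lambda>g. \<lambda>k\<in>M. \<Sum>x\<in>S. g x * u k x)"
  have "card (M \<rightarrow>\<^sub>E (UNIV :: 'a set)) < card (S \<rightarrow>\<^sub>E (UNIV :: 'a set))"
    using assms card_field_gt_1[where 'a='a] by (simp add: card_PiE)
  moreover have "finite (S \<rightarrow>\<^sub>E (UNIV :: 'a set))" "finite (M \<rightarrow>\<^sub>E (UNIV :: 'a set))"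
    using assms by (auto intro: finite_PiE)
  moreover have "\<phi> ` (S \<rightarrow>\<^sub>E UNIV) \<subseteq> (M \<rightarrow>\<^sub>E UNIV)" by (auto simp: \<phi>_def)
  ultimately have "\<not> inj_on \<phi> (S \<rightarrow>\<^sub>E UNIV)"
    by (metis card_inj_on_le linorder_not_le)
  then obtain g h where gh: "g \<in> S \<rightarrow>\<^sub>E UNIV" "h \<in> S \<rightarrow>\<^sub>E UNIV" "\<phi> g = \<phi> h" "g \<noteq> h"
    by (auto simp: inj_on_def)
  have "(\<Sum>x\<in>S. (if x \<in> S then g x - h x else 0) * u k x) = 0" if "k \<in> M" for k
    using fun_cong[OF gh(3), of k] that by (simp add: \<phi>_def algebra_simps sum_subtractf)
  moreover have "\<exists>x\<in>S. g x \<noteq> h x" using gh PiE_ext[OF gh(1,2)] by blast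
  ultimately show ?thesis by (intro exI[of _ "\<lambda>x. if x \<in> S then g x - h x else 0"]) auto
qed

text \<open>Choose an annihilator \<open>h\<close> of maximal support. If more than
  \<open>card M\<close> points of \<open>S\<close> were outside its support, a nonzero annihilator
  living on these points could be added to it and would enlarge the support.\<close>

lemma large_support_annihilator:
  fixes u :: "'k \<Rightarrow> 'b \<Rightarrow> 'a::{field,finite}"
  assumes S: "finite S" and M: "finite M"
  obtains h where "\<And>k. k \<in> M \<Longrightarrow> (\<Sum>x\<in>S. h x * u k x) = 0" "card S \<le> card M + card {x\<in>S. h x \<noteq> 0}"
proof -
  define V where "V = {h. \<forall>k\<in>M. (\<Sum>x\<in>S. h x * u k x) = 0}"
  have "(\<lambda>_. 0) \<in> V" by (simp add: V_def)
  moreover have "\<forall>h. h \<in> V \<longrightarrow> card {x\<in>S. h x \<noteq> 0} < Suc (card S)"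
    using S by (auto simp: less_Suc_eq_le intro!: card_mono)
  ultimately have "\<exists>h. h \<in> V \<and> (\<forall>h'. h' \<in> V \<longrightarrow> card {x\<in>S. h' x \<noteq> 0} \<le> card {x\<in>S. h x \<noteq> 0})"
    by (rule ex_has_greatest_nat[where P="\<lambda>h. h \<in> V" and f="\<lambda>h. card {x\<in>S. h x \<noteq> 0}"])
  then obtain h where h: "h \<in> V" "\<And>h'. h' \<in> V \<Longrightarrow> card {x\<in>S. h' x \<noteq> 0} \<le> card {x\<in>S. h x \<noteq> 0}"
    by auto
  have "card S \<le> card M + card {x\<in>S. h x \<noteq> 0}"
  proof (rule ccontr)
    define T where "T = {x\<in>S. h x \<noteq> 0}"
    assume "\<not> ?thesis"
    hence c: "card M < card (S - T)" using S by (subst card_Diff_subset) (auto simp: T_def)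
    obtain g where g: "\<exists>x\<in>S-T. g x \<noteq> 0" "\<And>x. x \<notin> S-T \<Longrightarrow> g x = 0" "\<And>k. k \<in> M \<Longrightarrow> (\<Sum>x\<in>S-T. g x * u k x) = 0"
      using underdetermined_system[OF finite_Diff[OF S] M c, of u] by blast
    have "(\<Sum>x\<in>S. g x * u k x) = 0" if "k \<in> M" for k
    proof -
      have "(\<Sum>x\<in>S. g x * u k x) = (\<Sum>x\<in>S-T. g x * u k x)"
        using S g(2) by (intro sum.mono_neutral_right) auto
      thus ?thesis using g(3) that by simp
    qed
    hence "(\<lambda>x. h x + g x) \<in> V" using h(1) by (simp add: V_def algebra_simps sum.distrib)
    hence "card {x\<in>S. h x + g x \<noteq> 0} \<le> card T" using h(2) T_def by blast
    moreover have "T \<subset> {x\<in>S. h x + g x \<noteq> 0}"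
      using g(1,2) by (auto simp: T_def)
    ultimately show False using S psubset_card_mono[of "{x\<in>S. h x + g x \<noteq> 0}" T] by auto
  qed
  thus thesis using h(1) that V_def by blast
qed

text \<open>A diagonal tensor has full slice rank (Tao); here the slices use the same functions
  \<open>u\<close> in all three directions. Summing over \<open>z\<close> against \<open>h\<close>
  kills the third kind of slice and leaves a diagonal matrix with at least
  \<open>card S - card M\<close> nonzero entries, written as a sum of \<open>2 * card M\<close>
  matrices of rank one.\<close>

lemma slice_rank_diagonal:
  fixes u :: "'k \<Rightarrow> 'b \<Rightarrow> 'a::{field,finite}"
  assumes S: "finite S" and M: "finite M"
    and eq: "\<And>x y z. x \<in> S \<Longrightarrow> y \<in> S \<Longrightarrow> z \<in> S \<Longrightarrow>
      (\<Sum>k\<in>M. u k x * F k y z) + (\<Sum>k\<in>M. u k y * G k x z) + (\<Sum>k\<in>M. u k z * H k x y)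
        = (if x = y \<and> y = z then 1 else 0)"
  shows "card S \<le> 3 * card M"
proof -
  obtain h where h: "\<And>k. k \<in> M \<Longrightarrow> (\<Sum>z\<in>S. h z * u k z) = 0" "card S \<le> card M + card {x\<in>S. h x \<noteq> 0}"
    using large_support_annihilator[OF S M, of u] by blast
  define T where "T = {x\<in>S. h x \<noteq> 0}"
  have T: "finite T" "T \<subseteq> S" using S by (auto simp: T_def)
  have diag: "(\<Sum>k\<in>M. u k x * (\<Sum>z\<in>S. h z * F k y z)) + (\<Sum>k\<in>M. u k y * (\<Sum>z\<in>S. h z * G k x z))
      = (if x = y then h x else 0)" if "x \<in> S" "y \<in> S" for x y
  proof -
    have "(\<Sum>k\<in>M. u k x * (\<Sum>z\<in>S. h z * F k y z)) + (\<Sum>k\<in>M. u k y * (\<Sum>z\<in>S. h z * G k x z))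
       + (\<Sum>k\<in>M. H k x y * (\<Sum>z\<in>S. h z * u k z))
       = (\<Sum>z\<in>S. h z * ((\<Sum>k\<in>M. u k x * F k y z) + (\<Sum>k\<in>M. u k y * G k x z) + (\<Sum>k\<in>M. u k z * H k x y)))"
      by (simp add: sum_distrib_left distrib_left sum.distrib mult_ac sum.swap[of _ S M])
    also have "\<dots> = (\<Sum>z\<in>S. h z * (if x = y \<and> y = z then 1 else 0))"
      using that by (intro sum.cong refl) (simp add: eq)
    also have "\<dots> = (\<Sum>z\<in>S. if z = y then (if x = y then h y else 0) else 0)"
      by (intro sum.cong) auto
    also have "\<dots> = (if x = y then h x else 0)" using S that by (auto simp: sum.delta)
    finally show ?thesis using h(1) by simp
  qed
  have "card T \<le> 2 * card M"
  proof (rule ccontr)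
    assume "\<not> card T \<le> 2 * card M"
    hence c: "card (M \<times> (UNIV::bool set)) < card T" by (simp add: card_cartesian_product mult.commute)
    \<comment> \<open>These are the \<open>2 * card M\<close> functions of \<open>x\<close> in the
      remaining slices. A vector \<open>g\<close> orthogonal to all of them annihilates the left
      side of \<open>diag\<close>, while the right side gives \<open>g y * h y\<close>.\<close>
    define w where "w = (\<lambda>(k, b) x. if b then u k x else (\<Sum>z\<in>S. h z * G k x z))"
    obtain g where g: "\<exists>x\<in>T. g x \<noteq> 0" "\<And>p. p \<in> M \<times> UNIV \<Longrightarrow> (\<Sum>x\<in>T. g x * w p x) = 0"
      using underdetermined_system[OF T(1) _ c, of w] M by (metis finite_SigmaI finite)
    have g1: "(\<Sum>x\<in>T. g x * u k x) = 0" "(\<Sum>x\<in>T. g x * (\<Sum>z\<in>S. h z * G k x z)) = 0" if "k \<in> M" for k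
      using g(2)[of "(k, True)"] g(2)[of "(k, False)"] that by (auto simp: w_def)
    obtain y where y: "y \<in> T" "g y \<noteq> 0" using g(1) by blast
    have "g y * h y = (\<Sum>x\<in>T. g x * (if x = y then h x else 0))"
      using T y by (simp add: if_distrib[of "(*) _"] sum.delta cong: if_cong)
    also have "\<dots> = (\<Sum>x\<in>T. g x * ((\<Sum>k\<in>M. u k x * (\<Sum>z\<in>S. h z * F k y z)) + (\<Sum>k\<in>M. u k y * (\<Sum>z\<in>S. h z * G k x z))))"
      using T y by (intro sum.cong refl) (subst diag, auto)
    also have "\<dots> = (\<Sum>k\<in>M. (\<Sum>z\<in>S. h z * F k y z) * (\<Sum>x\<in>T. g x * u k x)) +
        (\<Sum>k\<in>M. u k y * (\<Sum>x\<in>T. g x * (\<Sum>z\<in>S. h z * G k x z)))"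
      by (simp add: sum_distrib_left sum_distrib_right distrib_left sum.distrib mult_ac sum.swap[of _ T])
    also have "\<dots> = 0" using g1 by simp
    finally show False using y by (auto simp: T_def)
  qed
  thus ?thesis using h(2) by (simp add: T_def)
qed

section \<open>The polynomial method for one equation in three variables\<close>

lemma finite_field_power_card_minus_1:
  fixes x :: "'a::{field,finite}"
  assumes "x \<noteq> 0"
  shows "x ^ (CARD('a) - 1) = 1"
proof -
  have "(\<Prod>y\<in>UNIV-{0}. x * y) = x ^ (CARD('a) - 1) * \<Prod>(UNIV-{0::'a})"
    by (simp add: prod.distrib card_Diff_singleton)
  moreover have "(\<Prod>y\<in>UNIV-{0}. x * y) = \<Prod>(UNIV-{0::'a})"
    by (rule prod.reindex_bij_witness[of _ "\<lambda>y. y / x" "\<lambda>y. x * y"]) (use assms in auto)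
  moreover have "\<Prod>(UNIV-{0::'a}) \<noteq> 0" by simp
  ultimately show ?thesis by simp
qed

definition exponent_triples :: "nat \<Rightarrow> (nat \<times> nat \<times> nat) set" where
  "exponent_triples N = {(i, j, l). i + j + l \<le> N}"

lemma finite_exponent_triples: "finite (exponent_triples N)"
  by (rule finite_subset[of _ "{..N} \<times> {..N} \<times> {..N}"]) (auto simp: exponent_triples_def)

text \<open>The coefficients are fixed before \<open>x\<close>, \<open>y\<close>, \<open>z\<close>,
  as a decomposition into slices requires. The constant 1 is absorbed by the exponents
  \<open>(0, 0, 0)\<close>, which is why exponent sums below \<open>N\<close> are allowed.\<close>

lemma trinomial_expansion:
  fixes a b c :: "'a::comm_ring_1"
  obtains \<kappa> where "\<And>x y z. 1 - (a * x + b * y + c * z) ^ N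
     = (\<Sum>(i, j, l)\<in>exponent_triples N. \<kappa> (i, j, l) * x ^ i * y ^ j * z ^ l)"
proof -
  define T where "T = exponent_triples N"
  define C where "C = (\<lambda>(i, j, l). of_nat (N choose i) * of_nat ((N - i) choose j) * a ^ i * b ^ j * c ^ l :: 'a)"
  define \<kappa> where "\<kappa> = (\<lambda>(i, j, l). (if (i, j, l) = (0, 0, 0) then 1 else 0) - (if i + j + l = N then C (i, j, l) else 0))"
  have "1 - (a * x + b * y + c * z) ^ N = (\<Sum>(i, j, l)\<in>T. \<kappa> (i, j, l) * x ^ i * y ^ j * z ^ l)" for x y z
  proof -
    have "(a * x + b * y + c * z) ^ N = (a * x + (b * y + c * z)) ^ N" by (simp add: add.assoc)
    also have "\<dots> = (\<Sum>i\<le>N. of_nat (N choose i) * (a * x) ^ i * (b * y + c * z) ^ (N - i))"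
      by (rule binomial_ring)
    also have "\<dots> = (\<Sum>i\<le>N. \<Sum>j\<le>N-i. C (i, j, N - i - j) * x ^ i * y ^ j * z ^ (N - i - j))"
      by (simp add: binomial_ring sum_distrib_left C_def power_mult_distrib mult_ac)
    also have "\<dots> = (\<Sum>(i, j)\<in>(SIGMA i:{..N}. {..N-i}). C (i, j, N - i - j) * x ^ i * y ^ j * z ^ (N - i - j))"
      by (subst sum.Sigma) auto
    also have "\<dots> = (\<Sum>(i, j, l)\<in>{t\<in>T. case t of (i, j, l) \<Rightarrow> i + j + l = N}. C (i, j, l) * x ^ i * y ^ j * z ^ l)"
      by (rule sum.reindex_bij_witness[of _ "\<lambda>(i, j, l). (i, j)" "\<lambda>(i, j). (i, j, N - i - j)"])
         (auto simp: T_def exponent_triples_def)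
    also have "\<dots> = (\<Sum>(i, j, l)\<in>T. (if i + j + l = N then C (i, j, l) else 0) * x ^ i * y ^ j * z ^ l)"
      using finite_exponent_triples[of N] by (intro sum.mono_neutral_cong_left) (auto simp: T_def split: if_splits)
    finally have 1: "(a * x + b * y + c * z) ^ N = \<dots>" .
    have "(\<Sum>(i, j, l)\<in>T. (if (i, j, l) = (0, 0, 0) then 1 else 0) * x ^ i * y ^ j * z ^ l)
       = (\<Sum>t\<in>T. if t = (0, 0, 0) then 1 else 0)"
      by (intro sum.cong) (auto split: if_splits)
    also have "\<dots> = 1" using finite_exponent_triples[of N] by (simp add: T_def exponent_triples_def)
    finally have 2: "(\<Sum>(i, j, l)\<in>T. (if (i, j, l) = (0, 0, 0) then 1 else 0) * x ^ i * y ^ j * z ^ l) = 1" .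
    show ?thesis unfolding 1 using 2
      by (simp add: \<kappa>_def left_diff_distrib sum_subtractf case_prod_unfold cong: if_cong)
  qed
  thus thesis using that unfolding T_def by blast
qed

text \<open>Exponents of the monomials of degree at most a third of \<open>(q - 1) * n\<close>. As
  \<open>(q - 1) * n\<close> bounds the total degree of the polynomial used below, each of its
  monomials is of this kind in at least one of the three groups of variables.\<close>

definition low_exponents :: "nat \<Rightarrow> nat \<Rightarrow> (nat \<Rightarrow> nat) set" where
  "low_exponents q n = {a \<in> {..<n} \<rightarrow>\<^sub>E {..<q}. 3 * (\<Sum>t<n. a t) \<le> (q - 1) * n}"

lemma finite_low_exponents: "finite (low_exponents q n)"
  unfolding low_exponents_def by (rule finite_subset[of _ "{..<n} \<rightarrow>\<^sub>E {..<q}"]) (auto intro: finite_PiE)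

text \<open>Nonzero field elements have power \<open>q - 1\<close> equal to 1, so the product over
  \<open>t < n\<close> of \<open>1 - (c1 * x t + c2 * y t + c3 * z t) ^ (q - 1)\<close> is the
  indicator of the solutions. By \<open>triv\<close> and \<open>sum0\<close> it is the diagonal
  tensor on \<open>S\<close>, and its expansion into monomials is a sum of few slices.\<close>

lemma cap_set_slice_rank:
  fixes c1 c2 c3 :: "'a::{field,finite}" and S :: "(nat \<Rightarrow> 'a) set"
  assumes sum0: "c1 + c2 + c3 = 0" and S: "S \<subseteq> vecs n"
    and triv: "\<And>x y z. x \<in> S \<Longrightarrow> y \<in> S \<Longrightarrow> z \<in> S \<Longrightarrow> (\<And>t. c1 * x t + c2 * y t + c3 * z t = 0) \<Longrightarrow> x = y \<and> y = z"
  shows "card S \<le> 3 * card (low_exponents CARD('a) n)"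
proof -
  define q where "q = CARD('a)"
  have q: "q > 1" using card_field_gt_1 by (simp add: q_def)
  define M where "M = low_exponents q n"
  obtain \<kappa> where \<kappa>: "\<And>x y z. 1 - (c1 * x + c2 * y + c3 * z) ^ (q - 1)
     = (\<Sum>(i, j, l)\<in>exponent_triples (q - 1). \<kappa> (i, j, l) * x ^ i * y ^ j * z ^ l)"
    using trinomial_expansion[of c1 c2 c3 "q - 1"] by blast
  define All where "All = ({..<n} \<rightarrow>\<^sub>E exponent_triples (q - 1))"
  have finA: "finite All" unfolding All_def by (intro finite_PiE finite_exponent_triples) auto
  define e1 where "e1 = (\<lambda>\<sigma>::nat \<Rightarrow> nat \<times> nat \<times> nat. \<lambda>t\<in>{..<n}. fst (\<sigma> t))"
  define e2 where "e2 = (\<lambda>\<sigma>::nat \<Rightarrow> nat \<times> nat \<times> nat. \<lambda>t\<in>{..<n}. fst (snd (\<sigma> t)))"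
  define e3 where "e3 = (\<lambda>\<sigma>::nat \<Rightarrow> nat \<times> nat \<times> nat. \<lambda>t\<in>{..<n}. snd (snd (\<sigma> t)))"
  define u where "u = (\<lambda>a (x::nat \<Rightarrow> 'a). \<Prod>t<n. x t ^ a t)"
  define K where "K = (\<lambda>\<sigma>. \<Prod>t<n. \<kappa> (\<sigma> t))"
  \<comment> \<open>Monomials are sorted by the first group of variables in which their degree is
    low, so that each belongs to exactly one kind of slice.\<close>
  define A1 where "A1 = {\<sigma>\<in>All. e1 \<sigma> \<in> M}"
  define A2 where "A2 = {\<sigma>\<in>All. e1 \<sigma> \<notin> M \<and> e2 \<sigma> \<in> M}"
  define A3 where "A3 = {\<sigma>\<in>All. e1 \<sigma> \<notin> M \<and> e2 \<sigma> \<notin> M}"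
  have fin: "finite A1" "finite A2" "finite A3" using finA by (auto simp: A1_def A2_def A3_def)
  have A3M: "e3 ` A3 \<subseteq> M"
  proof safe
    fix \<sigma> assume \<sigma>: "\<sigma> \<in> A3"
    hence A: "\<And>t. t < n \<Longrightarrow> fst (\<sigma> t) + fst (snd (\<sigma> t)) + snd (snd (\<sigma> t)) \<le> q - 1"
      by (fastforce simp: A3_def All_def PiE_iff exponent_triples_def case_prod_unfold)
    have r: "e1 \<sigma> \<in> {..<n} \<rightarrow>\<^sub>E {..<q}" "e2 \<sigma> \<in> {..<n} \<rightarrow>\<^sub>E {..<q}" "e3 \<sigma> \<in> {..<n} \<rightarrow>\<^sub>E {..<q}"
      unfolding e1_def e2_def e3_def using A q by (force simp: PiE_iff)+
    have s: "(q - 1) * n < 3 * (\<Sum>t<n. fst (\<sigma> t))" "(q - 1) * n < 3 * (\<Sum>t<n. fst (snd (\<sigma> t)))"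
      using \<sigma> r by (auto simp: A3_def M_def low_exponents_def e1_def e2_def)
    have "(\<Sum>t<n. fst (\<sigma> t) + fst (snd (\<sigma> t)) + snd (snd (\<sigma> t))) \<le> (\<Sum>t<n. q - 1)"
      using A by (intro sum_mono) auto
    hence "(\<Sum>t<n. fst (\<sigma> t)) + (\<Sum>t<n. fst (snd (\<sigma> t))) + (\<Sum>t<n. snd (snd (\<sigma> t))) \<le> (q - 1) * n"
      by (simp add: sum.distrib mult.commute)
    hence "3 * (\<Sum>t<n. snd (snd (\<sigma> t))) \<le> (q - 1) * n" using s by linarith
    thus "e3 \<sigma> \<in> M" using r by (auto simp: M_def low_exponents_def e3_def)
  qed
  define F where "F = (\<lambda>a y z. \<Sum>\<sigma>\<in>{\<sigma>\<in>A1. e1 \<sigma> = a}. K \<sigma> * u (e2 \<sigma>) y * u (e3 \<sigma>) z)"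
  define G where "G = (\<lambda>a x z. \<Sum>\<sigma>\<in>{\<sigma>\<in>A2. e2 \<sigma> = a}. K \<sigma> * u (e1 \<sigma>) x * u (e3 \<sigma>) z)"
  define H where "H = (\<lambda>a x y. \<Sum>\<sigma>\<in>{\<sigma>\<in>A3. e3 \<sigma> = a}. K \<sigma> * u (e1 \<sigma>) x * u (e2 \<sigma>) y)"
  have finM: "finite M" by (simp add: M_def finite_low_exponents)
  show ?thesis unfolding q_def[symmetric] M_def[symmetric]
  proof (rule slice_rank_diagonal[where u=u and F=F and G=G and H=H])
    show "finite S" using S finite_vecs finite_subset by blast
    show "finite M" by fact
    fix x y z assume xyz: "x \<in> S" "y \<in> S" "z \<in> S"
    let ?m = "\<lambda>\<sigma>. K \<sigma> * u (e1 \<sigma>) x * u (e2 \<sigma>) y * u (e3 \<sigma>) z"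
    have "(\<Sum>k\<in>M. u k x * F k y z) = (\<Sum>k\<in>M. \<Sum>\<sigma>\<in>{\<sigma>\<in>A1. e1 \<sigma> = k}. ?m \<sigma>)"
      unfolding F_def sum_distrib_left by (intro sum.cong refl) (auto simp: mult_ac)
    also have "\<dots> = sum ?m A1" by (rule sum.group) (use fin finM in \<open>auto simp: A1_def\<close>)
    finally have 1: "(\<Sum>k\<in>M. u k x * F k y z) = sum ?m A1" .
    have "(\<Sum>k\<in>M. u k y * G k x z) = (\<Sum>k\<in>M. \<Sum>\<sigma>\<in>{\<sigma>\<in>A2. e2 \<sigma> = k}. ?m \<sigma>)"
      unfolding G_def sum_distrib_left by (intro sum.cong refl) (auto simp: mult_ac)
    also have "\<dots> = sum ?m A2" by (rule sum.group) (use fin finM in \<open>auto simp: A2_def\<close>)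
    finally have 2: "(\<Sum>k\<in>M. u k y * G k x z) = sum ?m A2" .
    have "(\<Sum>k\<in>M. u k z * H k x y) = (\<Sum>k\<in>M. \<Sum>\<sigma>\<in>{\<sigma>\<in>A3. e3 \<sigma> = k}. ?m \<sigma>)"
      unfolding H_def sum_distrib_left by (intro sum.cong refl) (auto simp: mult_ac)
    also have "\<dots> = sum ?m A3" by (rule sum.group) (use fin finM A3M in auto)
    finally have 3: "(\<Sum>k\<in>M. u k z * H k x y) = sum ?m A3" .
    have "All = A1 \<union> (A2 \<union> A3)" by (auto simp: A1_def A2_def A3_def)
    moreover have "A1 \<inter> (A2 \<union> A3) = {}" "A2 \<inter> A3 = {}" by (auto simp: A1_def A2_def A3_def)
    ultimately have "sum ?m All = sum ?m A1 + (sum ?m A2 + sum ?m A3)"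
      using fin by (simp add: sum.union_disjoint)
    hence "sum ?m A1 + sum ?m A2 + sum ?m A3 = sum ?m All" by (simp add: add.assoc)
    also have "\<dots> = (\<Sum>\<sigma>\<in>All. \<Prod>t<n. case \<sigma> t of (i, j, l) \<Rightarrow> \<kappa> (i, j, l) * x t ^ i * y t ^ j * z t ^ l)"
      by (simp add: K_def u_def e1_def e2_def e3_def prod.distrib case_prod_unfold)
    also have "\<dots> = (\<Prod>t<n. 1 - (c1 * x t + c2 * y t + c3 * z t) ^ (q - 1))"
      unfolding All_def \<kappa> by (rule prod_sum_PiE[symmetric]) (auto simp: finite_exponent_triples)
    also have "\<dots> = (if x = y \<and> y = z then 1 else 0)"
    proof (cases "\<forall>t<n. c1 * x t + c2 * y t + c3 * z t = 0")
      case True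
      hence "c1 * x t + c2 * y t + c3 * z t = 0" for t
      proof (cases "t < n")
        case False
        hence "x t = 0 \<and> y t = 0 \<and> z t = 0" using xyz S by (simp add: vecs_def subset_iff)
        thus ?thesis by simp
      qed (use True in simp)
      hence "x = y \<and> y = z" using triv xyz by blast
      thus ?thesis using True q by (simp add: zero_power)
    next
      case False
      then obtain t where t: "t < n" "c1 * x t + c2 * y t + c3 * z t \<noteq> 0" by blast
      have ne: "\<not> (x = y \<and> y = z)"
        using t(2) sum0 by (metis distrib_right mult_zero_left)
      have "(\<Prod>t<n. 1 - (c1 * x t + c2 * y t + c3 * z t) ^ (q - 1)) = 0"
        using t finite_field_power_card_minus_1[OF t(2)] by (intro prod_zero) (auto simp: q_def)
      thus ?thesis unfolding if_not_P[OF ne] .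
    qed
    finally show "(\<Sum>k\<in>M. u k x * F k y z) + (\<Sum>k\<in>M. u k y * G k x z) + (\<Sum>k\<in>M. u k z * H k x y) = (if x = y \<and> y = z then 1 else 0)"
      unfolding 1 2 3 .
  qed
qed

text \<open>Chernoff's bound: \<open>\<gamma>\<close> is the value at some \<open>\<mu> < 1\<close> of \<open>\<Sum>i<q. \<mu> ^ (3 * i) / \<mu> ^ (q - 1)\<close>,
  which equals \<open>q\<close> with positive derivative at \<open>\<mu> = 1\<close>.\<close>

lemma card_low_exponents:
  assumes q: "q > 1"
  obtains \<gamma> :: real where "0 < \<gamma>" "\<gamma> < real q" "\<And>n. real (card (low_exponents q n)) \<le> \<gamma> ^ n"
proof -
  \<comment> \<open>For \<open>\<mu> > 0\<close>, positivity of \<open>f \<mu>\<close> says that the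
    bound \<open>\<gamma>\<close> below is smaller than \<open>q\<close>. As \<open>f 1 = 0\<close>,
    a negative derivative at 1 provides such a \<open>\<mu>\<close> just below 1.\<close>
  define f where "f = (\<lambda>\<mu>::real. real q * \<mu> ^ (q - 1) - (\<Sum>i<q. \<mu> ^ (3 * i)))"
  have deriv: "DERIV f 1 :> real q * real (q - 1) - (\<Sum>i<q. 3 * real i)"
    unfolding f_def by (auto intro!: derivative_eq_intros)
  have "(\<Sum>i<q. 3 * real i) = 3 * (real q * real (q - 1) / 2)"
  proof -
    have "2 * (\<Sum>i<q. real i) = real q * real (q - 1)"
    proof (induction q)
      case (Suc q)
      thus ?case by (cases q) (simp_all add: algebra_simps)
    qed simp
    thus ?thesis by (simp add: sum_distrib_left[symmetric])
  qed
  hence "real q * real (q - 1) - (\<Sum>i<q. 3 * real i) = - (real q * real (q - 1) / 2)" by simp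
  hence "DERIV f 1 :> - (real q * real (q - 1) / 2)" using deriv by (simp only:)
  moreover have "- (real q * real (q - 1) / 2) < 0" using q by simp
  ultimately obtain d where d: "d > 0" "\<And>h. h > 0 \<Longrightarrow> h < d \<Longrightarrow> f 1 < f (1 - h)"
    using DERIV_neg_dec_left by blast
  define \<mu> where "\<mu> = 1 - min (d / 2) (1 / 2)"
  have \<mu>: "0 < \<mu>" "\<mu> < 1" using d(1) by (auto simp: \<mu>_def)
  have "f 1 < f \<mu>" unfolding \<mu>_def using d(1) by (intro d(2)) auto
  hence f: "(\<Sum>i<q. \<mu> ^ (3 * i)) < real q * \<mu> ^ (q - 1)" by (simp add: f_def)
  define \<gamma> where "\<gamma> = (\<Sum>i<q. \<mu> ^ (3 * i)) / \<mu> ^ (q - 1)"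
  show thesis
  proof (rule that[of \<gamma>])
    show "0 < \<gamma>" unfolding \<gamma>_def using \<mu> q by (intro divide_pos_pos sum_pos) (auto simp: lessThan_empty_iff)
    show "\<gamma> < real q" using f \<mu> by (simp add: \<gamma>_def divide_simps)
    fix n
    have "real (card (low_exponents q n)) = (\<Sum>a\<in>low_exponents q n. 1)" by simp
    \<comment> \<open>Since \<open>\<mu> < 1\<close>, every low exponent vector has weight at least
      1, and the total weight of all exponent vectors factors over the coordinates.\<close>
    also have "\<dots> \<le> (\<Sum>a\<in>low_exponents q n. \<Prod>t<n. \<mu> ^ (3 * a t) / \<mu> ^ (q - 1))"
    proof (rule sum_mono)
      fix a assume a: "a \<in> low_exponents q n"
      have "\<mu> ^ ((q - 1) * n) \<le> \<mu> ^ (3 * (\<Sum>t<n. a t))"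
        using a \<mu> by (intro power_decreasing) (auto simp: low_exponents_def)
      moreover have "(\<Prod>t<n. \<mu> ^ (3 * a t) / \<mu> ^ (q - 1)) = \<mu> ^ (3 * (\<Sum>t<n. a t)) / \<mu> ^ ((q - 1) * n)"
        by (simp add: prod_dividef power_sum sum_distrib_left power_mult)
      ultimately show "1 \<le> (\<Prod>t<n. \<mu> ^ (3 * a t) / \<mu> ^ (q - 1))" using \<mu> by simp
    qed
    also have "\<dots> \<le> (\<Sum>a\<in>{..<n} \<rightarrow>\<^sub>E {..<q}. \<Prod>t<n. \<mu> ^ (3 * a t) / \<mu> ^ (q - 1))"
    proof (rule sum_mono2)
      show "finite ({..<n} \<rightarrow>\<^sub>E {..<q})" by (intro finite_PiE) auto
      show "low_exponents q n \<subseteq> {..<n} \<rightarrow>\<^sub>E {..<q}" unfolding low_exponents_def by blast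
      show "0 \<le> (\<Prod>t<n. \<mu> ^ (3 * a t) / \<mu> ^ (q - 1))" for a :: "nat \<Rightarrow> nat"
        using \<mu> by (intro prod_nonneg) simp
    qed
    also have "\<dots> = (\<Prod>t<n. \<Sum>i<q. \<mu> ^ (3 * i) / \<mu> ^ (q - 1))"
      by (rule prod_sum_PiE[symmetric]) auto
    also have "\<dots> = \<gamma> ^ n" by (simp add: \<gamma>_def sum_divide_distrib)
    finally show "real (card (low_exponents q n)) \<le> \<gamma> ^ n" .
  qed
qed

subsection \<open>Counting solutions\<close>

text \<open>Gaussian elimination: the last equation determines a variable with nonzero coefficient
  from the other ones, and eliminating it keeps the remaining equations independent. The right sides
  \<open>b\<close> are arbitrary because later the value of a linear form and one of the entries are
  prescribed.\<close>

lemma card_solutions_le: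
  fixes f :: "nat \<Rightarrow> 'i \<Rightarrow> 'a::field" and S :: "(nat \<Rightarrow> 'a) set"
  assumes "finite I" "finite S"
    and "\<And>w. (\<And>r. r \<in> I \<Longrightarrow> (\<Sum>i<l. w i * f i r) = 0) \<Longrightarrow> \<forall>i<l. w i = 0"
  shows "card {y \<in> I \<rightarrow>\<^sub>E S. \<forall>i<l. \<forall>t. (\<Sum>r\<in>I. f i r * y r t) = b i t} * card S ^ l \<le> card S ^ card I"
  using assms
proof (induction l arbitrary: I f b)
  case 0
  show ?case using 0 by (simp add: card_PiE)
next
  case (Suc l)
  let ?X = "{y \<in> I \<rightarrow>\<^sub>E S. \<forall>i<Suc l. \<forall>t. (\<Sum>r\<in>I. f i r * y r t) = b i t}"
  have "\<exists>j\<in>I. f l j \<noteq> 0"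
  proof (rule ccontr)
    assume "\<not> ?thesis"
    hence "\<forall>i<Suc l. (if i = l then 1 else 0 :: 'a) = 0"
      by (intro Suc.prems(3)) (auto intro!: sum.neutral)
    thus False by auto
  qed
  then obtain j where j: "j \<in> I" "f l j \<noteq> 0" by blast
  define J where "J = I - {j}"
  have J: "finite J" "j \<notin> J" "I = insert j J" using j Suc.prems(1) by (auto simp: J_def)
  define g where "g = (\<lambda>i r. f i r - f i j / f l j * f l r)"
  define b' where "b' = (\<lambda>i t. b i t - f i j / f l j * b l t)"
  let ?Y = "{y \<in> J \<rightarrow>\<^sub>E S. \<forall>i<l. \<forall>t. (\<Sum>r\<in>J. g i r * y r t) = b' i t}"
  have indep: "\<forall>i<l. w i = 0" if w: "\<And>r. r \<in> J \<Longrightarrow> (\<Sum>i<l. w i * g i r) = 0" for w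
  proof -
    \<comment> \<open>The weight given to row \<open>l\<close> cancels the pivot column, which turns
      a relation among the reduced rows \<open>g\<close> into one among the rows of
      \<open>f\<close>.\<close>
    define W where "W = w(l := - (\<Sum>i<l. w i * f i j) / f l j)"
    have W: "(\<Sum>i<Suc l. W i * f i r) = (\<Sum>i<l. w i * g i r)" for r
      by (simp add: W_def g_def algebra_simps sum_subtractf sum_distrib_left sum_divide_distrib)
    have "(\<Sum>i<Suc l. W i * f i r) = 0" if "r \<in> I" for r
      using that w j(2) unfolding W J(3) by (auto simp: g_def)
    hence "\<forall>i<Suc l. W i = 0" by (rule Suc.prems(3))
    show ?thesis
    proof (intro allI impI)
      fix i assume "i < l"
      thus "w i = 0" using \<open>\<forall>i<Suc l. W i = 0\<close>[rule_format, of i] by (simp add: W_def)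
    qed
  qed
  have IH: "card ?Y * card S ^ l \<le> card S ^ card J"
    by (rule Suc.IH[OF J(1) Suc.prems(2) indep])
  have "card ?X \<le> card ?Y"
  proof (rule card_inj_on_le[where f = "\<lambda>y. restrict y J"])
    show "inj_on (\<lambda>y. restrict y J) ?X"
    proof (rule inj_onI)
      fix y z assume y: "y \<in> ?X" and z: "z \<in> ?X" and eq: "restrict y J = restrict z J"
      have eq': "y r = z r" if "r \<in> J" for r using fun_cong[OF eq, of r] that by simp
      have "y j t = z j t" for t
      proof -
        have "(\<Sum>r\<in>I. f l r * y r t) = (\<Sum>r\<in>I. f l r * z r t)" using y z by auto
        moreover have "(\<Sum>r\<in>J. f l r * y r t) = (\<Sum>r\<in>J. f l r * z r t)" using eq' by simp
        ultimately show ?thesis using j(2) J by simp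
      qed
      hence "y j = z j" by (rule ext)
      thus "y = z" using y z eq' J(3) by (intro PiE_ext[of y I "\<lambda>_. S" z]) auto
    qed
    show "(\<lambda>y. restrict y J) ` ?X \<subseteq> ?Y"
    proof (rule image_subsetI)
      fix y assume y: "y \<in> ?X"
      have "(\<Sum>r\<in>J. g i r * restrict y J r t) = b' i t" if "i < l" for i t
      proof -
        have "(\<Sum>r\<in>J. g i r * restrict y J r t) = (\<Sum>r\<in>J. g i r * y r t)" by simp
        also have "\<dots> = (\<Sum>r\<in>I. g i r * y r t)" using J j(2) by (simp add: g_def)
        also have "\<dots> = (\<Sum>r\<in>I. f i r * y r t) - f i j / f l j * (\<Sum>r\<in>I. f l r * y r t)"
          by (simp add: g_def algebra_simps sum_subtractf sum_distrib_left sum_divide_distrib)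
        also have "\<dots> = b' i t" using y that by (simp add: b'_def)
        finally show ?thesis .
      qed
      moreover have "restrict y J \<in> J \<rightarrow>\<^sub>E S"
        using y J(3) by (intro restrict_PiE_iff[THEN iffD2]) auto
      ultimately show "restrict y J \<in> ?Y" by simp
    qed
    have "finite (J \<rightarrow>\<^sub>E S)" using J(1) Suc.prems(2) by (intro finite_PiE) auto
    thus "finite ?Y" by simp
  qed
  hence "card ?X * card S ^ Suc l \<le> card ?Y * card S ^ Suc l" by (rule mult_le_mono1)
  also have "\<dots> = card S * (card ?Y * card S ^ l)" by simp
  also have "\<dots> \<le> card S * card S ^ card J" using IH by (rule mult_le_mono2)
  also have "\<dots> = card S ^ card I" using J by simp
  finally show ?case .
qed

definition sols :: "(nat \<Rightarrow> nat \<Rightarrow> 'a::field) \<Rightarrow> nat \<Rightarrow> nat set \<Rightarrow> (nat \<Rightarrow> 'a) set \<Rightarrow> (nat \<Rightarrow> nat \<Rightarrow> 'a) set" where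
  "sols f m I S = {y \<in> I \<rightarrow>\<^sub>E S. \<forall>i<m. \<forall>t. (\<Sum>r\<in>I. f i r * y r t) = 0}"

lemma finite_sols: "finite I \<Longrightarrow> finite S \<Longrightarrow> finite (sols f m I S)"
  unfolding sols_def by (simp add: finite_PiE)

lemma sum_atLeastAtMost_double:
  fixes h :: "nat \<Rightarrow> 'b::comm_monoid_add"
  shows "(\<Sum>r\<in>{1..2*s}. h r) = (\<Sum>r\<in>{1..s}. h r + h (s + r))"
proof -
  have "(\<Sum>r\<in>{1..s+s}. h r) = (\<Sum>r\<in>{1..s}. h r) + (\<Sum>r\<in>{1..s}. h (r + s))"
    by (subst sum.ub_add_nat) (simp_all add: sum.shift_bounds_cl_nat_ivl[symmetric])
  thus ?thesis by (simp add: sum.distrib mult_2 add.commute)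
qed

text \<open>Cauchy-Schwarz for the fibre sizes \<open>N v\<close>: they add up to
  \<open>card A\<close>, and their squares add up to the number of pairs with equal image.\<close>

lemma card_collisions_ge:
  assumes "finite A" "finite V" "\<phi> ` A \<subseteq> V"
  shows "card A ^ 2 \<le> card {(a, b) \<in> A \<times> A. \<phi> a = \<phi> b} * card V"
proof -
  define N where "N = (\<lambda>v. card {a\<in>A. \<phi> a = v})"
  have "card A = (\<Sum>v\<in>V. N v)"
    using sum.group[OF assms, of "\<lambda>_. 1::nat"] by (simp add: N_def)
  hence "real (card A) = (\<Sum>v\<in>V. real (N v))" by simp
  hence "real (card A) ^ 2 \<le> (\<Sum>v\<in>V. (real (N v))\<^sup>2) * card V"
    using sum_squared_le_sum_of_squares by metis
  also have "(\<Sum>v\<in>V. (real (N v))\<^sup>2) = real (\<Sum>v\<in>V. N v ^ 2)" by simp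
  also have "(\<Sum>v\<in>V. N v ^ 2) = (\<Sum>v\<in>V. card ({a\<in>A. \<phi> a = v} \<times> {a\<in>A. \<phi> a = v}))"
    by (simp add: N_def card_cartesian_product power2_eq_square)
  also have "\<dots> = card (\<Union>v\<in>V. {a\<in>A. \<phi> a = v} \<times> {a\<in>A. \<phi> a = v})"
    using assms by (intro card_UN_disjoint[symmetric]) auto
  also have "(\<Union>v\<in>V. {a\<in>A. \<phi> a = v} \<times> {a\<in>A. \<phi> a = v}) = {(a, b) \<in> A \<times> A. \<phi> a = \<phi> b}"
    using assms(3) by auto
  finally show ?thesis by (simp only: of_nat_power[symmetric] of_nat_mult[symmetric] of_nat_le_iff)
qed

text \<open>By \<open>anti\<close>, two \<open>s\<close>-tuples with the same image under the linear
  map \<open>\<phi>\<close> form a solution, and \<open>\<phi>\<close> takes its values in a set of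
  size \<open>CARD('a) ^ (m * n)\<close>.\<close>

lemma card_sols_ge:
  fixes f :: "nat \<Rightarrow> nat \<Rightarrow> 'a::{field,finite}"
  assumes anti: "\<And>i r. i < m \<Longrightarrow> r \<in> {1..s} \<Longrightarrow> f i (s + r) = - f i r"
    and S: "S \<subseteq> vecs n"
  shows "card S ^ (2 * s) \<le> card (sols f m {1..2*s} S) * CARD('a) ^ (m * n)"
proof -
  have finS: "finite S" using S finite_vecs finite_subset by blast
  define A where "A = ({1..s} \<rightarrow>\<^sub>E S)"
  define V where "V = ({..<m} \<rightarrow>\<^sub>E (vecs n :: (nat \<Rightarrow> 'a) set))"
  define \<phi> where "\<phi> = (\<lambda>a. \<lambda>i\<in>{..<m}. \<lambda>t::nat. \<Sum>r\<in>{1..s}. f i r * a r t)"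
  have fin: "finite A" "finite V"
    unfolding A_def V_def using finS by (auto intro!: finite_PiE finite_vecs)
  have "\<phi> ` A \<subseteq> V"
  proof (rule image_subsetI)
    fix a assume a: "a \<in> A"
    have "(\<Sum>r\<in>{1..s}. f i r * a r t) = 0" if "n \<le> t" for i t
    proof (rule sum.neutral, rule ballI)
      fix r assume "r \<in> {1..s}"
      hence "a r \<in> vecs n" using a S unfolding A_def by blast
      thus "f i r * a r t = 0" using that by (simp add: vecs_def)
    qed
    thus "\<phi> a \<in> V" unfolding V_def \<phi>_def by (intro restrict_PiE_iff[THEN iffD2]) (simp add: vecs_def)
  qed
  hence 1: "card A ^ 2 \<le> card {(a, b) \<in> A \<times> A. \<phi> a = \<phi> b} * card V"
    by (intro card_collisions_ge fin)
  have 2: "card A ^ 2 = card S ^ (2 * s)"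
    by (simp add: A_def card_PiE power_mult[symmetric] mult.commute)
  have 3: "card V = CARD('a) ^ (m * n)"
    by (simp add: V_def card_PiE card_vecs power_mult[symmetric] mult.commute)
  have 4: "card {(a, b) \<in> A \<times> A. \<phi> a = \<phi> b} * card V \<le> card (sols f m {1..2*s} S) * card V"
  proof (rule mult_le_mono1, rule card_inj_on_le)
    let ?\<psi> = "\<lambda>(a, b). \<lambda>r\<in>{1..2*s}. if r \<le> s then a r else b (r - s)"
    show "inj_on ?\<psi> {(a, b) \<in> A \<times> A. \<phi> a = \<phi> b}"
    proof (rule inj_onI, clarify)
      fix a b a' b' assume A: "a \<in> A" "b \<in> A" "a' \<in> A" "b' \<in> A"
        and eq: "(\<lambda>r\<in>{1..2*s}. if r \<le> s then a r else b (r - s)) = (\<lambda>r\<in>{1..2*s}. if r \<le> s then a' r else b' (r - s))"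
      have "a r = a' r" "b r = b' r" if "r \<in> {1..s}" for r
        using fun_cong[OF eq, of r] fun_cong[OF eq, of "s + r"] that by auto
      show "a = a' \<and> b = b'"
        using A unfolding A_def by (intro conjI PiE_ext[of a _ "\<lambda>_. S" a'] PiE_ext[of b _ "\<lambda>_. S" b'] \<open>\<And>r. r \<in> {1..s} \<Longrightarrow> a r = a' r\<close> \<open>\<And>r. r \<in> {1..s} \<Longrightarrow> b r = b' r\<close>)
    qed
    show "?\<psi> ` {(a, b) \<in> A \<times> A. \<phi> a = \<phi> b} \<subseteq> sols f m {1..2*s} S"
    proof (rule image_subsetI, clarify)
      fix a b assume ab: "a \<in> A" "b \<in> A" and eq: "\<phi> a = \<phi> b"
      let ?y = "\<lambda>r\<in>{1..2*s}. if r \<le> s then a r else b (r - s)"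
      have S: "a r \<in> S" "b r \<in> S" if "r \<in> {1..s}" for r using ab that unfolding A_def by blast+
      have "(if r \<le> s then a r else b (r - s)) \<in> S" if "r \<in> {1..2*s}" for r
      proof (cases "r \<le> s")
        case True
        thus ?thesis using S(1)[of r] that by simp
      next
        case False
        hence "r - s \<in> {1..s}" using that by auto
        thus ?thesis using S(2) False by simp
      qed
      hence "?y \<in> {1..2*s} \<rightarrow>\<^sub>E S" by (intro restrict_PiE_iff[THEN iffD2]) blast
      moreover have "(\<Sum>r\<in>{1..2*s}. f i r * ?y r t) = 0" if "i < m" for i t
      proof -
        have "(\<Sum>r\<in>{1..2*s}. f i r * ?y r t) = (\<Sum>r\<in>{1..s}. f i r * a r t - f i r * b r t)"
          unfolding sum_atLeastAtMost_double by (intro sum.cong refl) (auto simp: anti that)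
        also have "\<dots> = \<phi> a i t - \<phi> b i t" using that by (simp add: \<phi>_def sum_subtractf)
        finally show ?thesis using eq by simp
      qed
      ultimately show "?y \<in> sols f m {1..2*s} S" unfolding sols_def by blast
    qed
    show "finite (sols f m {1..2*s} S)" using finS by (intro finite_sols) auto
  qed
  show ?thesis using order_trans[OF 1 4] unfolding 2 3 .
qed

lemma sum_delta_mult:
  assumes "finite I" "r \<in> I"
  shows "(\<Sum>x\<in>I. (if x = r then a else 0) * g x) = a * (g r :: 'a::semiring_0)"
proof -
  have "(\<Sum>x\<in>I. (if x = r then a else 0) * g x) = (\<Sum>x\<in>I. if x = r then a * g x else 0)"
    by (intro sum.cong) auto
  thus ?thesis using assms by simp
qed

text \<open>A system of the form \<open>\<Sum>r\<le>s. B r * (y r - y (s + r)) = 0\<close> has at least \<open>|S|^(2s) / q^(mn)\<close>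
  solutions in \<open>S\<close>, while each further independent equation costs a factor \<open>|S|\<close>. As \<open>|S|\<close> is close to
  \<open>q^n\<close>, most solutions have distinct entries, and most values of a further linear form \<open>e\<close> are attained so often
  that they can also be attained avoiding any few given vectors.\<close>

lemma generic_solution:
  fixes f :: "nat \<Rightarrow> nat \<Rightarrow> 'a::{field,finite}"
  assumes anti: "\<And>i r. i < m \<Longrightarrow> r \<in> {1..s} \<Longrightarrow> f i (s + r) = - f i r"
    and weight: "\<And>w a b r r'. r \<in> {1..2*s} \<Longrightarrow> r' \<in> {1..2*s} \<Longrightarrow>
       (\<And>x. x \<in> {1..2*s} \<Longrightarrow> (\<Sum>i<m. w i * f i x) = (if x = r then a else 0) + (if x = r' then b else 0)) \<Longrightarrow>
       \<forall>i<m. w i = 0"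
    and finE: "finite E"
    and indepE: "\<And>e w a r. e \<in> E \<Longrightarrow> r \<in> {1..2*s} \<Longrightarrow>
       \<not> (\<forall>x\<in>{1..2*s}. e x = (\<Sum>i<m. w i * f i x) + (if x = r then a else 0))"
  shows "for_dense (\<lambda>n S. \<exists>y\<in>sols f m {1..2*s} S. inj_on y {1..2*s} \<and>
     (\<forall>e\<in>E. \<forall>F. finite F \<and> card F \<le> N \<longrightarrow>
       (\<exists>z\<in>sols f m {1..2*s} S. inj_on z {1..2*s} \<and> z ` {1..2*s} \<inter> F = {} \<and>
         (\<forall>t. (\<Sum>r\<in>{1..2*s}. e r * z r t) = (\<Sum>r\<in>{1..2*s}. e r * y r t)))))"
proof -
  define I where "I = {1..2*s}"
  have I: "finite I" "card I = 2 * s" by (auto simp: I_def)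
  define q where "q = real CARD('a)"
  have q: "q > 1" using card_field_gt_1[where 'a='a] by (simp add: q_def)
  define C1 where "C1 = real ((2 * s) ^ 2)"
  define C2 where "C2 = real (card E * (2 * s * N))"
  define good where "good = (\<lambda>S y. \<forall>e\<in>E. \<forall>F. finite F \<and> card F \<le> N \<longrightarrow>
       (\<exists>z\<in>sols f m I S. inj_on z I \<and> z ` I \<inter> F = {} \<and>
         (\<forall>t. (\<Sum>r\<in>I. e r * z r t) = (\<Sum>r\<in>I. e r * y r t))))"
  \<comment> \<open>The first inequality is for solutions with two equal entries, the second for
    those with a rarely attained value of some \<open>e\<close>. The factors 2 keep either kind
    below half of the lower bound from \<open>card_sols_ge\<close>.\<close>
  have "for_dense (\<lambda>n S :: (nat \<Rightarrow> 'a) set. (2 * C1 * q ^ (m * n) < real (card S) ^ Suc m) \<and>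
    ((2 * C2 * q ^ (Suc m * n) < real (card S) ^ Suc (Suc m)) \<and> 1 \<le> card S))"
    unfolding q_def by (intro for_dense_conj for_dense_power_card for_dense_card)
  hence "for_dense (\<lambda>n S. \<exists>y\<in>sols f m I S. inj_on y I \<and> good S y)"
  proof (rule for_dense_mono)
    fix n and S :: "(nat \<Rightarrow> 'a) set"
    assume S: "S \<subseteq> vecs n" and big: "2 * C1 * q ^ (m * n) < real (card S) ^ Suc m \<and>
      (2 * C2 * q ^ (Suc m * n) < real (card S) ^ Suc (Suc m) \<and> 1 \<le> card S)"
    have finS: "finite S" using S finite_vecs finite_subset by blast
    define Q where "Q = real (card S)"
    have Q: "Q > 0" using big by (simp add: Q_def)
    define X where "X = Q ^ (2 * s)"
    have X: "X > 0" using Q by (simp add: X_def)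
    have finsol: "finite (sols f m I S)" by (intro finite_sols I finS)
    define Col where "Col = (\<lambda>(r, r'). {y\<in>sols f m I S. y r = y r'})"
    define U where "U = (\<lambda>e. {y\<in>sols f m I S. inj_on y I \<and> (\<exists>F. finite F \<and> card F \<le> N \<and>
       \<not> (\<exists>z\<in>sols f m I S. inj_on z I \<and> z ` I \<inter> F = {} \<and>
         (\<forall>t. (\<Sum>r\<in>I. e r * z r t) = (\<Sum>r\<in>I. e r * y r t))))})"
    define R where "R = {(r, r') \<in> I \<times> I. r \<noteq> r'}"
    have finR: "finite R" using I by (auto simp: R_def intro: finite_subset[of _ "I \<times> I"])
    have cardR: "real (card R) \<le> C1"
    proof -
      have "card R \<le> card (I \<times> I)" using I by (intro card_mono) (auto simp: R_def)
      hence "card R \<le> (2 * s) ^ 2" using I by (simp add: card_cartesian_product power2_eq_square)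
      thus ?thesis unfolding C1_def by (simp only: of_nat_le_iff)
    qed
    have Col: "real (card (Col p)) \<le> X / Q ^ Suc m" if "p \<in> R" for p
    proof -
      obtain r r' where p: "p = (r, r')" "r \<in> I" "r' \<in> I" "r \<noteq> r'"
        using \<open>p \<in> R\<close> unfolding R_def by blast
      \<comment> \<open>Row \<open>m\<close> is the additional equation \<open>y r = y r'\<close>;
        by \<open>weight\<close> it is independent of the other rows.\<close>
      define g where "g = (\<lambda>i x. if i < m then f i x else (if x = r then 1 else 0) + (if x = r' then - 1 else 0))"
      let ?Y = "{y \<in> I \<rightarrow>\<^sub>E S. \<forall>i<Suc m. \<forall>t. (\<Sum>r\<in>I. g i r * y r t) = 0}"
      have "Col p \<subseteq> ?Y"
      proof
        fix y assume y: "y \<in> Col p"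
        have "(\<Sum>x\<in>I. g m x * y x t) = 0" for t
          using p y by (simp add: g_def Col_def distrib_right sum.distrib sum_delta_mult I)
        thus "y \<in> ?Y" using y p by (auto simp: Col_def sols_def g_def less_Suc_eq)
      qed
      moreover have "finite ?Y" using I finS by (simp add: finite_PiE)
      ultimately have "card (Col p) \<le> card ?Y" by (intro card_mono)
      moreover have "card ?Y * card S ^ Suc m \<le> card S ^ card I"
      proof (rule card_solutions_le[OF I(1) finS, where b = "\<lambda>_ _. 0"])
        fix w assume w: "\<And>x. x \<in> I \<Longrightarrow> (\<Sum>i<Suc m. w i * g i x) = 0"
        have w': "(\<Sum>i<m. w i * f i x) = (if x = r then - w m else 0) + (if x = r' then w m else 0)" if "x \<in> I" for x
          using w[OF that] by (auto simp: g_def add_eq_0_iff2 split: if_splits)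
        have w0: "\<forall>i<m. w i = 0" by (rule weight[of r r' w "- w m" "w m"]) (use p w' in \<open>auto simp: I_def\<close>)
        hence "w m = 0" using w'[OF p(2)] p(4) by simp
        thus "\<forall>i<Suc m. w i = 0" using w0 by (auto simp: less_Suc_eq)
      qed
      ultimately have "card (Col p) * card S ^ Suc m \<le> card S ^ card I"
        by (meson le_trans mult_le_mono1)
      hence "real (card (Col p)) * Q ^ Suc m \<le> X" unfolding Q_def X_def I(2)[symmetric]
        by (simp only: of_nat_power[symmetric] of_nat_mult[symmetric] of_nat_le_iff)
      thus ?thesis using Q by (simp add: pos_le_divide_eq)
    qed
    have U: "real (card (U e)) \<le> q ^ n * (real (2 * s * N) * (X / Q ^ Suc (Suc m)))" if e: "e \<in> E" for e
    proof -
      define val where "val = (\<lambda>y :: nat \<Rightarrow> nat \<Rightarrow> 'a. \<lambda>t. \<Sum>r\<in>I. e r * y r t)"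
      have val: "val ` U e \<subseteq> vecs n"
      proof (rule image_subsetI)
        fix y assume y: "y \<in> U e"
        have "val y t = 0" if "n \<le> t" for t
          unfolding val_def
        proof (rule sum.neutral, rule ballI)
          fix r assume "r \<in> I"
          hence "y r \<in> vecs n" using y S unfolding U_def sols_def by blast
          thus "e r * y r t = 0" using that by (simp add: vecs_def)
        qed
        thus "val y \<in> vecs n" by (simp add: vecs_def)
      qed
      have finU: "finite (U e)" using finsol by (simp add: U_def)
      have fib: "real (card {y\<in>U e. val y = v}) \<le> real (2 * s * N) * (X / Q ^ Suc (Suc m))" for v
      proof (cases "{y\<in>U e. val y = v} = {}")
        case True
        thus ?thesis using X Q by (simp only: True card.empty) simp
      next
        case False
        then obtain y0 where y0: "y0 \<in> U e" "val y0 = v" by blast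
        then obtain F where F: "finite F" "card F \<le> N"
          "\<not> (\<exists>z\<in>sols f m I S. inj_on z I \<and> z ` I \<inter> F = {} \<and>
             (\<forall>t. (\<Sum>r\<in>I. e r * z r t) = (\<Sum>r\<in>I. e r * y0 r t)))"
          unfolding U_def by blast
        \<comment> \<open>The obstruction \<open>F\<close> of \<open>y0\<close> depends on
          \<open>y0\<close> only through its value \<open>v\<close>. So it blocks the whole fibre,
          each member of which must have some entry in \<open>F\<close>.\<close>
        have avoid: "val z \<noteq> v" if "z \<in> sols f m I S" "inj_on z I" "z ` I \<inter> F = {}" for z
        proof
          assume "val z = v"
          hence "\<forall>t. (\<Sum>r\<in>I. e r * z r t) = (\<Sum>r\<in>I. e r * y0 r t)"
            using y0(2) by (simp add: val_def fun_eq_iff)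
          thus False using F(3) that by blast
        qed
        define H where "H = (\<lambda>(r, u). {z \<in> sols f m I S. val z = v \<and> z r = u})"
        have sub: "{y\<in>U e. val y = v} \<subseteq> (\<Union>p\<in>I\<times>F. H p)"
        proof
          fix y assume y: "y \<in> {y\<in>U e. val y = v}"
          hence "y \<in> sols f m I S" "inj_on y I" "val y = v" by (auto simp: U_def)
          moreover from this avoid obtain r where "r \<in> I" "y r \<in> F" by blast
          ultimately show "y \<in> (\<Union>p\<in>I\<times>F. H p)"
            by (intro UN_I[of "(r, y r)"]) (auto simp: H_def)
        qed
        have H: "real (card (H p)) \<le> X / Q ^ Suc (Suc m)" if "p \<in> I \<times> F" for p
        proof -
          obtain r u where p: "p = (r, u)" "r \<in> I" using \<open>p \<in> I \<times> F\<close> by blast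
          \<comment> \<open>Two additional equations: the value of \<open>e\<close> is
            \<open>v\<close>, and the entry \<open>r\<close> is \<open>u\<close>. Independence
            follows from \<open>indepE\<close>, and then from \<open>weight\<close> with both
            positions equal to \<open>r\<close>.\<close>
          define g where "g = (\<lambda>i x. if i < m then f i x else if i = m then e x else if x = r then 1 else 0)"
          define b where "b = (\<lambda>i. if i < m then (\<lambda>_. 0) else if i = m then v else u)"
          let ?Y = "{y \<in> I \<rightarrow>\<^sub>E S. \<forall>i<Suc (Suc m). \<forall>t. (\<Sum>r\<in>I. g i r * y r t) = b i t}"
          have "H p \<subseteq> ?Y"
          proof
            fix y assume y: "y \<in> H p"
            have "(\<Sum>x\<in>I. g m x * y x t) = b m t" for t
              using y p by (auto simp: g_def b_def H_def val_def)
            moreover have "(\<Sum>x\<in>I. g (Suc m) x * y x t) = b (Suc m) t" for t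
              using y p sum_delta_mult[OF I(1) p(2), of 1 "\<lambda>x. y x t"] by (simp add: g_def b_def H_def)
            ultimately show "y \<in> ?Y" using y p by (auto simp: H_def sols_def g_def b_def less_Suc_eq)
          qed
          moreover have "finite ?Y" using I finS by (simp add: finite_PiE)
          ultimately have "card (H p) \<le> card ?Y" by (intro card_mono)
          moreover have "card ?Y * card S ^ Suc (Suc m) \<le> card S ^ card I"
          proof (rule card_solutions_le[OF I(1) finS])
            fix w assume w: "\<And>x. x \<in> I \<Longrightarrow> (\<Sum>i<Suc (Suc m). w i * g i x) = 0"
            have w': "(\<Sum>i<m. w i * f i x) + w m * e x + (if x = r then w (Suc m) else 0) = 0" if "x \<in> I" for x
              using w[OF that] by (simp add: g_def if_distrib[of "(*) _"] cong: if_cong)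
            have wm: "w m = 0"
            proof (rule ccontr)
              assume wm: "w m \<noteq> 0"
              have "e x = (\<Sum>i<m. (- w i / w m) * f i x) + (if x = r then - w (Suc m) / w m else 0)" if "x \<in> I" for x
              proof -
                have "w m * e x = - (\<Sum>i<m. w i * f i x) - (if x = r then w (Suc m) else 0)"
                  using w'[OF that] by (simp add: algebra_simps eq_neg_iff_add_eq_0)
                hence "e x = (- (\<Sum>i<m. w i * f i x) - (if x = r then w (Suc m) else 0)) / w m"
                  using wm by (simp add: eq_divide_eq mult.commute)
                thus ?thesis by (simp add: diff_divide_distrib sum_divide_distrib sum_negf)
              qed
              thus False using indepE[OF e, of r "\<lambda>i. - w i / w m" "- w (Suc m) / w m"] p(2)
                by (auto simp: I_def)
            qed
            have w'': "(\<Sum>i<m. w i * f i x) = (if x = r then - w (Suc m) else 0) + (if x = r then 0 else 0)" if "x \<in> I" for x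
              using w'[OF that] wm by (auto simp: add_eq_0_iff2 split: if_splits)
            have w0: "\<forall>i<m. w i = 0" by (rule weight[of r r w "- w (Suc m)" 0]) (use p w'' in \<open>auto simp: I_def\<close>)
            hence "w (Suc m) = 0" using w''[OF p(2)] by simp
            thus "\<forall>i<Suc (Suc m). w i = 0" using w0 wm by (auto simp: less_Suc_eq)
          qed
          ultimately have "card (H p) * card S ^ Suc (Suc m) \<le> card S ^ card I"
            by (meson le_trans mult_le_mono1)
          hence "real (card (H p)) * Q ^ Suc (Suc m) \<le> X" unfolding Q_def X_def I(2)[symmetric]
            by (simp only: of_nat_power[symmetric] of_nat_mult[symmetric] of_nat_le_iff)
          thus ?thesis using Q by (simp add: pos_le_divide_eq)
        qed
        have finH: "finite (\<Union>p\<in>I\<times>F. H p)"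
          using finsol I F by (auto simp: H_def)
        have "card {y\<in>U e. val y = v} \<le> (\<Sum>p\<in>I\<times>F. card (H p))"
          using card_mono[OF finH sub] card_UN_le[of "I \<times> F" H] I F by simp
        hence "real (card {y\<in>U e. val y = v}) \<le> (\<Sum>p\<in>I\<times>F. real (card (H p)))"
          by (simp only: of_nat_sum[symmetric] of_nat_le_iff)
        also have "\<dots> \<le> real (card (I \<times> F)) * (X / Q ^ Suc (Suc m))"
          using H by (intro sum_bounded_above) auto
        also have "\<dots> \<le> real (2 * s * N) * (X / Q ^ Suc (Suc m))"
        proof -
          have "card (I \<times> F) \<le> 2 * s * N" using I F by (simp add: card_cartesian_product)
          hence "real (card (I \<times> F)) \<le> real (2 * s * N)" by (simp only: of_nat_le_iff)
          thus ?thesis using X Q by (intro mult_right_mono) auto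
        qed
        finally show ?thesis .
      qed
      \<comment> \<open>Up to \<open>q ^ n\<close> values have to be summed over. This loss is the
        reason why \<open>Suc m\<close> powers of \<open>q ^ n\<close> must be beaten by
        \<open>Suc (Suc m)\<close> powers of \<open>card S\<close>.\<close>
      have "card (U e) = (\<Sum>v\<in>vecs n. card {y\<in>U e. val y = v})"
        using sum.group[OF finU finite_vecs val, of "\<lambda>_. 1::nat"] by simp
      hence "real (card (U e)) = (\<Sum>v\<in>vecs n. real (card {y\<in>U e. val y = v}))" by simp
      also have "\<dots> \<le> real (card (vecs n :: (nat \<Rightarrow> 'a) set)) * (real (2 * s * N) * (X / Q ^ Suc (Suc m)))"
        using fib by (intro sum_bounded_above) auto
      finally show ?thesis by (simp add: card_vecs q_def)
    qed
    show "\<exists>y\<in>sols f m I S. inj_on y I \<and> good S y"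
    proof (rule ccontr)
      assume none: "\<not> ?thesis"
      have "sols f m I S \<subseteq> (\<Union>p\<in>R. Col p) \<union> (\<Union>e\<in>E. U e)"
      proof
        fix y assume y: "y \<in> sols f m I S"
        show "y \<in> (\<Union>p\<in>R. Col p) \<union> (\<Union>e\<in>E. U e)"
        proof (cases "inj_on y I")
          case True
          hence "\<not> good S y" using none y by blast
          hence "\<exists>e\<in>E. y \<in> U e" using y True unfolding good_def U_def by blast
          thus ?thesis by blast
        next
          case False
          then obtain r r' where "r \<in> I" "r' \<in> I" "r \<noteq> r'" "y r = y r'" unfolding inj_on_def by blast
          thus ?thesis using y by (intro UnI1 UN_I[of "(r, r')"]) (auto simp: R_def Col_def)
        qed
      qed
      moreover have "finite ((\<Union>p\<in>R. Col p) \<union> (\<Union>e\<in>E. U e))"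
        using finR finE finsol by (auto simp: Col_def U_def)
      ultimately have "card (sols f m I S) \<le> card ((\<Union>p\<in>R. Col p) \<union> (\<Union>e\<in>E. U e))"
        by (intro card_mono)
      also have "\<dots> \<le> (\<Sum>p\<in>R. card (Col p)) + (\<Sum>e\<in>E. card (U e))"
        using card_Un_le[of "\<Union>p\<in>R. Col p" "\<Union>e\<in>E. U e"] card_UN_le[OF finR, of Col] card_UN_le[OF finE, of U]
        by linarith
      finally have "real (card (sols f m I S)) \<le> (\<Sum>p\<in>R. real (card (Col p))) + (\<Sum>e\<in>E. real (card (U e)))"
        by (simp only: of_nat_sum[symmetric] of_nat_add[symmetric] of_nat_le_iff)
      also have "\<dots> \<le> real (card R) * (X / Q ^ Suc m) + real (card E) * (q ^ n * (real (2 * s * N) * (X / Q ^ Suc (Suc m))))"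
        using Col U by (intro add_mono sum_bounded_above) auto
      also have "\<dots> \<le> C1 * (X / Q ^ Suc m) + C2 * q ^ n * (X / Q ^ Suc (Suc m))"
        using cardR X Q by (intro add_mono mult_right_mono) (auto simp: C2_def mult_ac)
      also have "\<dots> < X / q ^ (m * n)"
      proof -
        have qm: "q ^ (m * n) > 0" using q by simp
        have "2 * (C1 * (X / Q ^ Suc m)) < X / q ^ (m * n)"
          using mult_strict_right_mono[of "2 * C1 * q ^ (m * n)" "Q ^ Suc m" X] big Q X qm
          unfolding Q_def[symmetric] by (simp add: divide_simps mult_ac)
        moreover have "2 * (C2 * q ^ n * (X / Q ^ Suc (Suc m))) < X / q ^ (m * n)"
          using mult_strict_right_mono[of "2 * C2 * q ^ (Suc m * n)" "Q ^ Suc (Suc m)" X] big Q X qm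
          unfolding Q_def[symmetric] by (simp add: divide_simps mult_ac power_add)
        ultimately show ?thesis by linarith
      qed
      also have "\<dots> \<le> real (card (sols f m I S))"
      proof -
        have "card S ^ (2 * s) \<le> card (sols f m I S) * CARD('a) ^ (m * n)"
          unfolding I_def by (rule card_sols_ge[of m s f, OF _ S]) (rule anti)
        hence "X \<le> real (card (sols f m I S)) * q ^ (m * n)" unfolding X_def Q_def q_def
          by (simp only: of_nat_power[symmetric] of_nat_mult[symmetric] of_nat_le_iff)
        thus ?thesis using q by (simp add: pos_divide_le_eq)
      qed
      finally show False by simp
    qed
  qed
  thus ?thesis unfolding good_def I_def .
qed

subsection \<open>Representations with distinct vectors\<close>

definition rep :: "(nat \<Rightarrow> 'a::field) set \<Rightarrow> nat set \<Rightarrow> (nat \<Rightarrow> 'a) \<Rightarrow> (nat \<Rightarrow> 'a) \<Rightarrow> bool" where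
  "rep S D c v \<longleftrightarrow> (\<exists>x. (\<forall>j\<in>D. x j \<in> S) \<and> inj_on x D \<and> (\<forall>t. (\<Sum>j\<in>D. c j * x j t) = v t))"

text \<open>For a singleton \<open>D\<close> the only representation of \<open>sum c D * y\<close> is by \<open>y\<close> itself, hence the restriction on \<open>F\<close>.\<close>

definition robust :: "nat \<Rightarrow> (nat \<Rightarrow> 'a::field) set \<Rightarrow> nat set \<Rightarrow> (nat \<Rightarrow> 'a) \<Rightarrow> (nat \<Rightarrow> 'a) \<Rightarrow> bool" where
  "robust N S D c y \<longleftrightarrow> (\<forall>F. finite F \<and> card F \<le> N \<and> (card D = 1 \<longrightarrow> y \<notin> F) \<longrightarrow>
     rep (S - F) D c (\<lambda>t. sum c D * y t))"

text \<open>Nonzero coefficients with sum zero force all three entries of a solution to agree once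
  two of them do. A set without a representation therefore has only constant solutions, and the
  slice rank bound applies.\<close>

lemma rep_three:
  fixes c :: "nat \<Rightarrow> 'a::{field,finite}"
  assumes D: "card D = 3" "\<And>j. j \<in> D \<Longrightarrow> c j \<noteq> 0" "sum c D = 0"
  shows "for_dense (\<lambda>n S. rep S D c (\<lambda>_. 0))"
proof -
  obtain i j k where ijk: "D = {i, j, k}" "i \<noteq> j" "j \<noteq> k" "i \<noteq> k"
    using D(1) unfolding card_3_iff by blast
  have c: "c i \<noteq> 0" "c j \<noteq> 0" "c k \<noteq> 0" "c i + c j + c k = 0" using D ijk by (auto simp: add.assoc)
  obtain \<gamma> :: real where \<gamma>: "0 < \<gamma>" "\<gamma> < real CARD('a)" "\<And>n. real (card (low_exponents CARD('a) n)) \<le> \<gamma> ^ n"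
    using card_low_exponents[OF card_field_gt_1] by blast
  show ?thesis
  \<comment> \<open>Any factor above the 3 of the slice rank bound would do.\<close>
  proof (rule for_denseI[of 4 \<gamma>])
    fix n and S :: "(nat \<Rightarrow> 'a) set"
    assume S: "S \<subseteq> vecs n" and big: "4 * \<gamma> ^ n \<le> real (card S)"
    show "rep S D c (\<lambda>_. 0)"
    proof (rule ccontr)
      assume no: "\<not> ?thesis"
      have "card S \<le> 3 * card (low_exponents CARD('a) n)"
      proof (rule cap_set_slice_rank[OF c(4) S])
        fix x y z assume xyz: "x \<in> S" "y \<in> S" "z \<in> S" and eq: "\<And>t. c i * x t + c j * y t + c k * z t = 0"
        have "x = y \<or> y = z \<or> x = z"
        proof (rule ccontr)
          assume ne: "\<not> ?thesis"
          let ?x = "(\<lambda>_. z)(i := x, j := y)"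
          have "inj_on ?x D" using ne ijk by (auto simp: inj_on_def)
          moreover have "\<forall>l\<in>D. ?x l \<in> S" using xyz by simp
          moreover have "(\<Sum>l\<in>D. c l * ?x l t) = 0" for t using ijk eq[of t] by (simp add: add.assoc)
          ultimately have "rep S D c (\<lambda>_. 0)" unfolding rep_def by blast
          thus False using no by simp
        qed
        moreover have "x = z" if "x = y"
        proof
          fix t
          have "c k * (z t - x t) = c i * x t + c j * y t + c k * z t - (c i + c j + c k) * x t"
            using that by (simp add: algebra_simps)
          thus "x t = z t" using eq c by simp
        qed
        moreover have "x = y" if "y = z"
        proof
          fix t
          have "c i * (x t - y t) = c i * x t + c j * y t + c k * z t - (c i + c j + c k) * y t"
            using that by (simp add: algebra_simps)
          thus "x t = y t" using eq c by simp
        qed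
        moreover have "x = y" if "x = z"
        proof
          fix t
          have "c j * (y t - x t) = c i * x t + c j * y t + c k * z t - (c i + c j + c k) * x t"
            using that by (simp add: algebra_simps)
          thus "x t = y t" using eq c by simp
        qed
        ultimately show "x = y \<and> y = z" by blast
      qed
      hence "real (card S) \<le> 3 * real (card (low_exponents CARD('a) n))" by simp
      also have "\<dots> \<le> 3 * \<gamma> ^ n" using \<gamma>(3) by simp
      finally have "4 * \<gamma> ^ n \<le> 3 * \<gamma> ^ n" using big by simp
      moreover have "\<gamma> ^ n > 0" using \<gamma>(1) by simp
      ultimately show False by simp
    qed
  qed (use \<gamma> in auto)
qed

text \<open>Let edges lead from \<open>v\<close> to the members of \<open>F v\<close>. The average
  in-degree is at most \<open>N\<close>, so some vertex has at most \<open>2 * N\<close> neighbours;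
  keep it, delete these and continue. Loops are tolerated, whence \<open>{v}\<close>.\<close>

lemma sparse_digraph_independent_set:
  fixes F :: "'b \<Rightarrow> 'b set"
  assumes "finite V" "\<And>v. v \<in> V \<Longrightarrow> finite (F v) \<and> card (F v) \<le> N"
  shows "\<exists>T\<subseteq>V. card V \<le> (2 * N + 1) * card T \<and> (\<forall>v\<in>T. F v \<inter> T \<subseteq> {v})"
  using assms
proof (induction V rule: finite_psubset_induct)
  case (psubset V)
  show ?case
  proof (cases "V = {}")
    case False
    define inn where "inn = (\<lambda>w. {v\<in>V. w \<in> F v})"
    have "(\<Sum>w\<in>V. card (inn w)) = (\<Sum>v\<in>V. card {w\<in>V. w \<in> F v})"
      unfolding inn_def by (rule sum_multicount_gen[symmetric]) (use psubset.hyps in auto)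
    also have "\<dots> \<le> (\<Sum>v\<in>V. N)"
    proof (rule sum_mono)
      fix v assume v: "v \<in> V"
      have "card {w\<in>V. w \<in> F v} \<le> card (F v)" using psubset.prems[OF v] by (intro card_mono) auto
      thus "card {w\<in>V. w \<in> F v} \<le> N" using psubset.prems[OF v] by simp
    qed
    finally have "(\<Sum>w\<in>V. card (inn w)) \<le> (\<Sum>v\<in>V. N)" .
    hence "\<exists>w\<in>V. card (inn w) \<le> N"
      using False psubset.hyps sum_strict_mono[of V "\<lambda>_. N" "\<lambda>w. card (inn w)"]
      by (meson linorder_not_le)
    then obtain w where w: "w \<in> V" "card (inn w) \<le> N" by blast
    define R where "R = {w} \<union> F w \<union> inn w"
    have R: "finite R" "card R \<le> 2 * N + 1"
    proof -
      show "finite R" using psubset w by (auto simp: R_def inn_def)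
      have "card R \<le> card {w} + card (F w) + card (inn w)"
        unfolding R_def by (meson card_Un_le le_trans add_le_mono1)
      thus "card R \<le> 2 * N + 1" using psubset.prems[OF w(1)] w(2) by simp
    qed
    have "V - R \<subset> V" using w by (auto simp: R_def)
    then obtain T where T: "T \<subseteq> V - R" "card (V - R) \<le> (2 * N + 1) * card T" "\<forall>v\<in>T. F v \<inter> T \<subseteq> {v}"
      using psubset.IH[of "V - R"] psubset.prems by blast
    have finT: "finite T" using T(1) psubset.hyps finite_subset by blast
    have "w \<notin> T" using T(1) by (auto simp: R_def)
    have "card V \<le> card (V - R) + card R"
      using psubset.hyps R(1) card_Un_le[of "V - R" R] card_mono[of "V - R \<union> R" V] by fastforce
    also have "\<dots> \<le> (2 * N + 1) * card (insert w T)"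
      using T(2) R(2) finT \<open>w \<notin> T\<close> by simp
    finally have "card V \<le> (2 * N + 1) * card (insert w T)" .
    moreover have "F v \<inter> insert w T \<subseteq> {v}" if "v \<in> insert w T" for v
      using that T(1,3) by (auto simp: R_def inn_def)
    moreover have "insert w T \<subseteq> V" using T(1) w(1) by blast
    ultimately show ?thesis by blast
  qed auto
qed

text \<open>For \<open>r \<in> G\<close> the representation may be forced to use the vector \<open>z r\<close>, which the other representations must
  therefore avoid.\<close>

lemma rep_family:
  fixes D :: "'r \<Rightarrow> nat set" and S :: "(nat \<Rightarrow> 'a::field) set"
  assumes "finite R"
    and "\<And>r. r \<in> R \<Longrightarrow> finite (D r)"
    and "\<And>r r'. r \<in> R \<Longrightarrow> r' \<in> R \<Longrightarrow> r \<noteq> r' \<Longrightarrow> D r \<inter> D r' = {}"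
    and "\<And>r F. r \<in> R \<Longrightarrow> finite F \<Longrightarrow> card F \<le> N \<Longrightarrow> (r \<in> G \<Longrightarrow> z r \<notin> F) \<Longrightarrow> rep (S - F) (D r) c (v r)"
    and "inj_on z (G \<inter> R)" "z ` (G \<inter> R) \<inter> F0 = {}"
    and "finite F0" "card F0 + card (G \<inter> R) + card (\<Union>r\<in>R. D r) \<le> N"
  shows "\<exists>x. (\<forall>r\<in>R. \<forall>j\<in>D r. x j \<in> S - F0) \<and> inj_on x (\<Union>r\<in>R. D r) \<and>
           (\<forall>r\<in>R. \<forall>t. (\<Sum>j\<in>D r. c j * x j t) = v r t)"
  using assms
proof (induction R arbitrary: F0)
  case empty
  show ?case by simp
next
  case (insert r R F0)
  define U where "U = (\<Union>r\<in>R. D r)"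
  have U: "finite U" "U \<inter> D r = {}" "(\<Union>r\<in>insert r R. D r) = D r \<union> U"
    using insert.hyps insert.prems(1) insert.prems(2)[of r] by (auto simp: U_def)
  have cardU: "card (D r \<union> U) = card (D r) + card U"
    using U insert.prems(1) by (intro card_Un_disjoint) auto
  \<comment> \<open>The vector that \<open>r\<close> may be forced to use is reserved while the
    other parts are treated. This moves one unit from \<open>card (G \<inter> R)\<close> to
    \<open>card F1\<close>, so the budget \<open>N\<close> still suffices.\<close>
  define F1 where "F1 = (if r \<in> G then insert (z r) F0 else F0)"
  have bound: "card F0 + card (G \<inter> insert r R) + (card (D r) + card U) \<le> N"
    using insert.prems(7) unfolding U(3) cardU .
  have cF: "card F1 + card (G \<inter> R) \<le> card F0 + card (G \<inter> insert r R)"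
    using insert.hyps insert.prems(6) by (auto simp: F1_def card_insert_if)
  have zF: "z ` (G \<inter> R) \<inter> F1 = {}"
    using insert.prems(4,5) insert.hyps by (auto simp: F1_def inj_on_def)
  have "\<exists>x. (\<forall>r\<in>R. \<forall>j\<in>D r. x j \<in> S - F1) \<and> inj_on x (\<Union>r\<in>R. D r) \<and>
           (\<forall>r\<in>R. \<forall>t. (\<Sum>j\<in>D r. c j * x j t) = v r t)"
  proof (rule insert.IH)
    show "inj_on z (G \<inter> R)" using insert.prems(4) by (rule inj_on_subset) auto
    show "card F1 + card (G \<inter> R) + card (\<Union>r\<in>R. D r) \<le> N" using bound cF by (simp add: U_def)
    show "finite F1" using insert.prems(6) by (simp add: F1_def)
  qed (use insert.prems zF in \<open>blast+\<close>)
  then obtain x where x: "\<forall>r\<in>R. \<forall>j\<in>D r. x j \<in> S - F1" "inj_on x U"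
     "\<forall>r\<in>R. \<forall>t. (\<Sum>j\<in>D r. c j * x j t) = v r t" unfolding U_def by blast
  define F where "F = F0 \<union> x ` U"
  have "finite F" using U insert.prems(6) by (simp add: F_def)
  moreover have "card F \<le> N"
    using card_Un_le[of F0 "x ` U"] card_image_le[OF U(1), of x] bound by (simp add: F_def)
  moreover have "z r \<notin> F" if "r \<in> G"
  proof -
    have "z r \<notin> F0" using that insert.prems(5) by auto
    moreover have "z r \<notin> x ` U"
    proof
      assume "z r \<in> x ` U"
      then obtain r' j where "r' \<in> R" "j \<in> D r'" "z r = x j" unfolding U_def by blast
      thus False using x(1) that by (metis DiffD2 F1_def insertI1)
    qed
    ultimately show ?thesis by (simp add: F_def)
  qed
  ultimately have "rep (S - F) (D r) c (v r)" using insert.prems(3)[of r F] by blast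
  then obtain y where y: "\<forall>j\<in>D r. y j \<in> S - F" "inj_on y (D r)" "\<forall>t. (\<Sum>j\<in>D r. c j * y j t) = v r t"
    unfolding rep_def by blast
  define w where "w = (\<lambda>j. if j \<in> D r then y j else x j)"
  have w: "w j = y j" if "j \<in> D r" for j using that by (simp add: w_def)
  have w': "w j = x j" if "j \<in> U" for j using that U(2) by (auto simp: w_def)
  show ?case
  proof (intro exI[of _ w] conjI)
    show "\<forall>r'\<in>insert r R. \<forall>j\<in>D r'. w j \<in> S - F0"
    proof (intro ballI)
      fix r' j assume r': "r' \<in> insert r R" and j: "j \<in> D r'"
      show "w j \<in> S - F0"
      proof (cases "j \<in> D r")
        case True
        thus ?thesis using y(1) by (auto simp: w F_def)
      next
        case False
        hence "r' \<in> R" using r' j by auto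
        moreover have "j \<in> U" using \<open>r' \<in> R\<close> j by (auto simp: U_def)
        ultimately show ?thesis using x(1) j by (auto simp: w' F1_def split: if_splits)
      qed
    qed
    have "inj_on w (D r)" using y(2) w by (simp cong: inj_on_cong)
    moreover have "inj_on w U" using x(2) w' by (simp cong: inj_on_cong)
    moreover have "w ` D r \<inter> w ` U = {}" using y(1) w w' by (auto simp: F_def)
    ultimately show "inj_on w (\<Union>r\<in>insert r R. D r)"
      unfolding U(3) using U(2) by (auto simp: inj_on_Un)
    show "\<forall>r'\<in>insert r R. \<forall>t. (\<Sum>j\<in>D r'. c j * w j t) = v r' t"
    proof (intro ballI allI)
      fix r' t assume r': "r' \<in> insert r R"
      show "(\<Sum>j\<in>D r'. c j * w j t) = v r' t"
      proof (cases "r' = r")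
        case True
        thus ?thesis using y(3) w by simp
      next
        case False
        hence "r' \<in> R" using r' by simp
        moreover have "w j = x j" if "j \<in> D r'" for j
          using that \<open>r' \<in> R\<close> by (intro w') (auto simp: U_def)
        ultimately show ?thesis using x(3) by simp
      qed
    qed
  qed
qed

section \<open>Robust vectors and balanced equations in at least three variables\<close>

lemma robust_singleton:
  assumes "card D = 1" "y \<in> S"
  shows "robust N S D c y"
proof -
  obtain j where "D = {j}" using assms(1) card_1_singletonE by blast
  thus ?thesis using assms(2) unfolding robust_def rep_def by (auto intro!: exI[of _ "\<lambda>_. y"])
qed

text \<open>If the exceptional set \<open>B\<close> were large, it would contain a large
  \<open>T\<close> in which the obstruction \<open>F v\<close> of a vector meets \<open>T\<close> at
  most in \<open>v\<close> itself. The variable \<open>j0\<close> with coefficient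
  \<open>- sum c D\<close> plays the role of \<open>y\<close>: a solution in \<open>T\<close> with
  distinct entries represents \<open>sum c D * x j0\<close> outside \<open>F (x j0)\<close>.\<close>

lemma few_not_robust:
  fixes c :: "nat \<Rightarrow> 'a::{field,finite}"
  assumes D: "finite D" "D \<noteq> {}" "j0 \<notin> D" and K: "K > 0"
    and IH: "card D \<ge> 2 \<Longrightarrow> for_dense (\<lambda>n S. rep S (insert j0 D) (c(j0 := - sum c D)) (\<lambda>_. 0))"
  shows "for_dense (\<lambda>n S. K * real (card {y\<in>S. \<not> robust N S D c y}) \<le> real (card S))"
proof (cases "card D \<ge> 2")
  case False
  hence "card D = 1" using D by (metis One_nat_def Suc_1 Suc_leI card_gt_0_iff le_antisym not_less_eq_eq)
  hence none: "{y\<in>S. \<not> robust N S D c y} = {}" for S using robust_singleton by blast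
  show ?thesis unfolding none by (rule for_dense_True) simp
next
  case True
  define K' where "K' = K * real (2 * N + 1)"
  have "for_dense (\<lambda>n S. \<forall>T\<subseteq>S. real (card S) \<le> K' * real (card T) \<longrightarrow> rep T (insert j0 D) (c(j0 := - sum c D)) (\<lambda>_. 0))"
    using K by (intro for_dense_subset IH True) (simp add: K'_def)
  thus ?thesis
  proof (rule for_dense_mono)
    fix n and S :: "(nat \<Rightarrow> 'a) set"
    assume S: "S \<subseteq> vecs n"
      and *: "\<forall>T\<subseteq>S. real (card S) \<le> K' * real (card T) \<longrightarrow> rep T (insert j0 D) (c(j0 := - sum c D)) (\<lambda>_. 0)"
    define B where "B = {y\<in>S. \<not> robust N S D c y}"
    have "finite S" using S finite_vecs finite_subset by blast
    hence finB: "finite B" by (simp add: B_def)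
    have "\<forall>y\<in>B. \<exists>F. finite F \<and> card F \<le> N \<and> \<not> rep (S - F) D c (\<lambda>t. sum c D * y t)"
      unfolding B_def robust_def by blast
    then obtain F where F: "\<And>y. y \<in> B \<Longrightarrow> finite (F y) \<and> card (F y) \<le> N \<and> \<not> rep (S - F y) D c (\<lambda>t. sum c D * y t)"
      by metis
    obtain T where T: "T \<subseteq> B" "card B \<le> (2 * N + 1) * card T" "\<forall>v\<in>T. F v \<inter> T \<subseteq> {v}"
      using sparse_digraph_independent_set[of B F N] finB F by blast
    show "K * real (card {y\<in>S. \<not> robust N S D c y}) \<le> real (card S)"
    proof (rule ccontr)
      assume "\<not> ?thesis"
      hence "real (card S) \<le> K * real (card B)" by (simp add: B_def)
      also have "\<dots> \<le> K * real ((2 * N + 1) * card T)" using T(2) K by (intro mult_left_mono of_nat_mono) auto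
      finally have "real (card S) \<le> K' * real (card T)" by (simp only: K'_def of_nat_mult mult.assoc)
      hence "rep T (insert j0 D) (c(j0 := - sum c D)) (\<lambda>_. 0)" using * T(1) by (auto simp: B_def)
      then obtain x where x: "\<forall>j\<in>insert j0 D. x j \<in> T" "inj_on x (insert j0 D)"
        "\<And>t. (\<Sum>j\<in>insert j0 D. (c(j0 := - sum c D)) j * x j t) = 0" unfolding rep_def by blast
      have "(\<Sum>j\<in>D. c j * x j t) = sum c D * x j0 t" for t
      proof -
        have "(\<Sum>j\<in>D. (c(j0 := - sum c D)) j * x j t) = (\<Sum>j\<in>D. c j * x j t)"
          using D(3) by (intro sum.cong) auto
        thus ?thesis using x(3)[of t] D by simp
      qed
      moreover have "\<forall>j\<in>D. x j \<in> S - F (x j0)"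
      proof
        fix j assume j: "j \<in> D"
        have "x j \<noteq> x j0" using x(2) j D(3) by (auto simp: inj_on_def)
        moreover have "F (x j0) \<inter> T \<subseteq> {x j0}" using T(3) x(1) by blast
        ultimately have "x j \<notin> F (x j0)" using x(1) j by blast
        thus "x j \<in> S - F (x j0)" using x(1) j T(1) by (auto simp: B_def)
      qed
      moreover have "inj_on x D" using x(2) by (rule inj_on_subset) auto
      ultimately have "rep (S - F (x j0)) D c (\<lambda>t. sum c D * x j0 t)" unfolding rep_def by blast
      moreover have "x j0 \<in> B" using x(1) T(1) by blast
      ultimately show False using F by blast
    qed
  qed
qed

text \<open>The one case in which no two or three variables can be merged: four equal coefficients in characteristic 2.\<close>

lemma rep_four_equal:
  fixes c :: "'a::{field,finite}"
  assumes "c + c = 0" "c \<noteq> 0" "card D = 4"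
  shows "for_dense (\<lambda>n S. rep S D (\<lambda>_. c) (\<lambda>_. 0))"
proof -
  \<comment> \<open>A single equation in two pairs of variables: since \<open>c = - c\<close>, four
    equal coefficients are antisymmetric. No popular values are needed, hence the empty set of
    forms.\<close>
  have "for_dense (\<lambda>n S. \<exists>y\<in>sols (\<lambda>_ _. c) 1 {1..2*2} S. inj_on y {1..2*2} \<and>
     (\<forall>e\<in>{}. \<forall>F. finite F \<and> card F \<le> 0 \<longrightarrow>
       (\<exists>z\<in>sols (\<lambda>_ _. c) 1 {1..2*2} S. inj_on z {1..2*2} \<and> z ` {1..2*2} \<inter> F = {} \<and>
         (\<forall>t. (\<Sum>r\<in>{1..2*2}. e r * z r t) = (\<Sum>r\<in>{1..2*2}. e r * y r t)))))"
  proof (rule generic_solution)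
    show "c = - c" using assms(1) by (simp add: eq_neg_iff_add_eq_0)
    fix w :: "nat \<Rightarrow> 'a" and a b :: 'a and r r' :: nat
    assume *: "\<And>x. x \<in> {1..2*2} \<Longrightarrow> (\<Sum>i<1. w i * c) = (if x = r then a else 0) + (if x = r' then b else 0)"
    have "\<exists>x\<in>{1, 2, 3}. x \<noteq> r \<and> x \<noteq> r'" by auto
    then obtain x :: nat where "x \<in> {1, 2, 3}" "x \<noteq> r" "x \<noteq> r'" by blast
    hence "x \<in> {1..2*2}" "x \<noteq> r" "x \<noteq> r'" by auto
    thus "\<forall>i<1. w i = 0" using *[of x] assms(2) by auto
  qed auto
  thus ?thesis
  proof (rule for_dense_mono)
    fix n and S :: "(nat \<Rightarrow> 'a) set"
    assume "\<exists>y\<in>sols (\<lambda>_ _. c) 1 {1..2*2} S. inj_on y {1..2*2} \<and>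
     (\<forall>e\<in>{}. \<forall>F. finite F \<and> card F \<le> 0 \<longrightarrow>
       (\<exists>z\<in>sols (\<lambda>_ _. c) 1 {1..2*2} S. inj_on z {1..2*2} \<and> z ` {1..2*2} \<inter> F = {} \<and>
         (\<forall>t. (\<Sum>r\<in>{1..2*2}. e r * z r t) = (\<Sum>r\<in>{1..2*2}. e r * y r t))))"
    then obtain y where y: "y \<in> sols (\<lambda>_ _. c) 1 {1..2*2} S" "inj_on y {1..2*2}" by blast
    have "finite D" using assms(3) card.infinite by fastforce
    then obtain h where h: "bij_betw h D {1..2*2::nat}"
      using finite_same_card_bij[of D "{1..2*2::nat}"] assms(3) by auto
    have "inj_on (y \<circ> h) D" using y(2) h by (intro comp_inj_on) (auto simp: bij_betw_def)
    moreover have "\<forall>j\<in>D. (y \<circ> h) j \<in> S"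
    proof
      fix j assume "j \<in> D"
      hence "h j \<in> {1..2*2}" by (rule bij_betw_apply[OF h])
      thus "(y \<circ> h) j \<in> S" using y(1) unfolding sols_def by auto
    qed
    moreover have "(\<Sum>j\<in>D. c * (y \<circ> h) j t) = 0" for t
      using sum.reindex_bij_betw[OF h, of "\<lambda>r. c * y r t"] y(1) by (auto simp: sols_def)
    ultimately show "rep S D (\<lambda>_. c) (\<lambda>_. 0)" unfolding rep_def by blast
  qed
qed

text \<open>The shortened equation is solved within the robust vectors, which make up at least half
  of \<open>S\<close>. Robustness of \<open>x a\<close> then spreads \<open>sum c A * x a\<close>
  over \<open>A\<close> while avoiding the vectors at the other positions.\<close>

lemma rep_merge:
  fixes c :: "nat \<Rightarrow> 'a::{field,finite}"
  assumes D: "finite D" "A \<subseteq> D" "card A \<ge> 2"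
    and a: "a \<in> A"
    and rob: "for_dense (\<lambda>n S. 2 * real (card {y\<in>S. \<not> robust (2 * card D) S A c y}) \<le> real (card S))"
    and merged: "for_dense (\<lambda>n S. rep S (insert a (D - A)) (c(a := sum c A)) (\<lambda>_. 0))"
  shows "for_dense (\<lambda>n S. rep S D c (\<lambda>_. 0))"
proof -
  have "for_dense (\<lambda>n S. 2 * real (card {y\<in>S. \<not> robust (2 * card D) S A c y}) \<le> real (card S) \<and>
    (\<forall>T\<subseteq>S. real (card S) \<le> 2 * real (card T) \<longrightarrow> rep T (insert a (D - A)) (c(a := sum c A)) (\<lambda>_. 0)))"
    by (intro for_dense_conj rob for_dense_subset merged) simp
  thus ?thesis
  proof (rule for_dense_mono)
    fix n and S :: "(nat \<Rightarrow> 'a) set"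
    assume S: "S \<subseteq> vecs n" and *: "2 * real (card {y\<in>S. \<not> robust (2 * card D) S A c y}) \<le> real (card S) \<and>
      (\<forall>T\<subseteq>S. real (card S) \<le> 2 * real (card T) \<longrightarrow> rep T (insert a (D - A)) (c(a := sum c A)) (\<lambda>_. 0))"
    have finS: "finite S" using S finite_vecs finite_subset by blast
    define T where "T = {y\<in>S. robust (2 * card D) S A c y}"
    have "S = T \<union> {y\<in>S. \<not> robust (2 * card D) S A c y}" by (auto simp: T_def)
    hence "card S \<le> card T + card {y\<in>S. \<not> robust (2 * card D) S A c y}"
      using card_Un_le by metis
    hence "real (card S) \<le> 2 * real (card T)" using * by linarith
    hence "rep T (insert a (D - A)) (c(a := sum c A)) (\<lambda>_. 0)" using * by (auto simp: T_def)
    then obtain x where x: "\<forall>j\<in>insert a (D - A). x j \<in> T" "inj_on x (insert a (D - A))"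
        "\<And>t. (\<Sum>j\<in>insert a (D - A). (c(a := sum c A)) j * x j t) = 0" unfolding rep_def by blast
    have fin: "finite A" "finite (D - A)" using D finite_subset by auto
    have "card (x ` (D - A)) \<le> 2 * card D"
      using card_image_le[OF fin(2), of x] card_mono[OF D(1), of "D - A"] by auto
    hence "rep (S - x ` (D - A)) A c (\<lambda>t. sum c A * x a t)"
      using x(1) D(3) fin by (auto simp: T_def robust_def)
    then obtain y where y: "\<forall>j\<in>A. y j \<in> S - x ` (D - A)" "inj_on y A"
      "\<And>t. (\<Sum>j\<in>A. c j * y j t) = sum c A * x a t" unfolding rep_def by blast
    define w where "w = (\<lambda>j. if j \<in> A then y j else x j)"
    have DA: "D = A \<union> (D - A)" using D(2) by blast
    have "\<forall>j\<in>D. w j \<in> S" using x(1) y(1) by (auto simp: w_def T_def)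
    moreover have "inj_on w D"
    proof -
      have "inj_on w A" using y(2) by (simp add: w_def cong: inj_on_cong)
      moreover have "inj_on w (D - A)" using inj_on_subset[OF x(2), of "D - A"] by (auto simp: w_def inj_on_def)
      moreover have "w ` A \<inter> w ` (D - A) = {}" using y(1) by (auto simp: w_def)
      ultimately have "inj_on w (A \<union> (D - A))" unfolding inj_on_Un by auto
      thus ?thesis using DA by simp
    qed
    moreover have "(\<Sum>j\<in>D. c j * w j t) = 0" for t
    proof -
      have "(\<Sum>j\<in>D. c j * w j t) = (\<Sum>j\<in>A. c j * w j t) + (\<Sum>j\<in>D-A. c j * w j t)"
        using fin by (subst DA, subst sum.union_disjoint) auto
      also have "\<dots> = (\<Sum>j\<in>A. c j * y j t) + (\<Sum>j\<in>D-A. c j * x j t)" by (simp add: w_def)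
      also have "\<dots> = (\<Sum>j\<in>insert a (D - A). (c(a := sum c A)) j * x j t)"
      proof -
        have "(\<Sum>j\<in>D-A. (c(a := sum c A)) j * x j t) = (\<Sum>j\<in>D-A. c j * x j t)"
          using a by (intro sum.cong) auto
        thus ?thesis using a fin y(3) by simp
      qed
      finally show ?thesis using x(3) by simp
    qed
    ultimately show "rep S D c (\<lambda>_. 0)" unfolding rep_def by blast
  qed
qed

text \<open>If any two coefficients cancel, then all equal some \<open>u\<close> with
  \<open>u + u = 0\<close>, and three of them add up to \<open>u\<close>, which is nonzero. The
  bound \<open>card A + 2 \<le> card D\<close> leaves three variables after merging, so such a
  triple needs \<open>card D \<ge> 5\<close>.\<close>

lemma exists_mergeable_subset:
  fixes c :: "nat \<Rightarrow> 'a::field"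
  assumes D: "finite D" "card D \<ge> 4" "\<And>j. j \<in> D \<Longrightarrow> c j \<noteq> 0"
  shows "(\<exists>A\<subseteq>D. 2 \<le> card A \<and> card A + 2 \<le> card D \<and> sum c A \<noteq> 0) \<or>
    card D = 4 \<and> (\<exists>u. u \<noteq> 0 \<and> u + u = 0 \<and> (\<forall>j\<in>D. c j = u))"
proof (cases "\<exists>i\<in>D. \<exists>j\<in>D. i \<noteq> j \<and> c i + c j \<noteq> 0")
  case True
  then obtain i j where "i \<in> D" "j \<in> D" "i \<noteq> j" "c i + c j \<noteq> 0" by blast
  thus ?thesis using D(2) by (intro disjI1 exI[of _ "{i, j}"]) auto
next
  case False
  hence neg: "c i + c j = 0" if "i \<in> D" "j \<in> D" "i \<noteq> j" for i j using that by blast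
  obtain T where T: "T \<subseteq> D" "card T = 3" using obtain_subset_with_card_n[of 3 D] D(2) by auto
  then obtain i j k where ijk: "T = {i, j, k}" "i \<noteq> j" "j \<noteq> k" "i \<noteq> k" unfolding card_3_iff by blast
  hence inD: "i \<in> D" "j \<in> D" "k \<in> D" using T by auto
  have ij: "c i = c j"
    using neg[of i k] neg[of j k] inD ijk by (metis add_right_cancel)
  hence two: "c i + c i = 0" using neg[of i j] inD ijk by simp
  have all: "c l = c i" if "l \<in> D" for l
    using neg[of l i] two that inD by (metis add_right_cancel)
  show ?thesis
  proof (cases "card D = 4")
    case True
    thus ?thesis using two all D(3)[OF inD(1)] by blast
  next
    case False
    have "sum c T = c i + c i + c i" using ijk all[OF inD(2)] all[OF inD(3)] by (simp add: add.assoc)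
    hence "sum c T \<noteq> 0" using two D(3)[OF inD(1)] by simp
    thus ?thesis using T False D(2) by (intro disjI1 exI[of _ T]) auto
  qed
qed

text \<open>Induction on the number of variables. Two shorter equations are used, the merged one and
  the one on \<open>insert j0 A\<close> behind the robustness of \<open>A\<close>; both still have
  at least three variables.\<close>

lemma rep_zero_dense:
  fixes c :: "nat \<Rightarrow> 'a::{field,finite}"
  assumes "finite D" "card D \<ge> 3" "\<And>j. j \<in> D \<Longrightarrow> c j \<noteq> 0" "sum c D = 0"
  shows "for_dense (\<lambda>n S. rep S D c (\<lambda>_. 0))"
  using assms
proof (induction "card D" arbitrary: D c rule: less_induct)
  case less
  show ?case
  proof (cases "card D = 3")
    case True
    thus ?thesis using less.prems by (intro rep_three) auto
  next
    case False
    hence "card D \<ge> 4" using less.prems by simp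
    hence "(\<exists>A\<subseteq>D. 2 \<le> card A \<and> card A + 2 \<le> card D \<and> sum c A \<noteq> 0) \<or>
      card D = 4 \<and> (\<exists>u. u \<noteq> 0 \<and> u + u = 0 \<and> (\<forall>j\<in>D. c j = u))"
      using less.prems by (intro exists_mergeable_subset) auto
    thus ?thesis
    proof (elim disjE conjE exE)
      fix u assume u: "card D = 4" "u \<noteq> 0" "u + u = 0" "\<forall>j\<in>D. c j = u"
      have "rep S D (\<lambda>_. u) (\<lambda>_. 0) = rep S D c (\<lambda>_. 0)" for S
        using u(4) by (simp add: rep_def)
      thus ?thesis using rep_four_equal[OF u(3,2,1)] by simp
    next
      fix A assume A: "A \<subseteq> D" "2 \<le> card A" "card A + 2 \<le> card D" "sum c A \<noteq> 0"
      have finA: "finite A" using A(1) less.prems(1) finite_subset by blast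
      obtain a where a: "a \<in> A" using A(2) by fastforce
      obtain j0 where j0: "j0 \<notin> A" using finA by (metis ex_new_if_finite infinite_UNIV_nat)
      show ?thesis
      proof (rule rep_merge[OF less.prems(1) A(1,2) a])
        show "for_dense (\<lambda>n S. 2 * real (card {y\<in>S. \<not> robust (2 * card D) S A c y}) \<le> real (card S))"
        proof (rule few_not_robust[OF finA _ j0])
          show "for_dense (\<lambda>n S. rep S (insert j0 A) (c(j0 := - sum c A)) (\<lambda>_. 0))"
          proof (rule less.hyps)
            show "sum (c(j0 := - sum c A)) (insert j0 A) = 0"
            proof -
              have "sum (c(j0 := - sum c A)) A = sum c A" using j0 by (intro sum.cong) auto
              thus ?thesis using finA j0 by simp
            qed
          qed (use A j0 finA less.prems(3) in auto)
        qed (use a in auto)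
        show "for_dense (\<lambda>n S. rep S (insert a (D - A)) (c(a := sum c A)) (\<lambda>_. 0))"
        proof (rule less.hyps)
          have c: "card (insert a (D - A)) = card D - card A + 1"
            using a less.prems(1) finA A(1) by (simp add: card_Diff_subset)
          show "card (insert a (D - A)) < card D" "3 \<le> card (insert a (D - A))" using c A by auto
          have "sum (c(a := sum c A)) (D - A) = sum c (D - A)" using a by (intro sum.cong) auto
          moreover have "sum c (D - A) + sum c A = sum c D" using A(1) less.prems(1) by (rule sum.subset_diff[symmetric])
          ultimately show "sum (c(a := sum c A)) (insert a (D - A)) = 0"
            using a less.prems by (simp add: add.commute)
        qed (use less.prems A in auto)
      qed
    qed
  qed
qed

lemma few_not_robust_dense:
  fixes c :: "nat \<Rightarrow> 'a::{field,finite}"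
  assumes D: "finite D" "D \<noteq> {}" "\<And>j. j \<in> D \<Longrightarrow> c j \<noteq> 0" "sum c D \<noteq> 0" and K: "K > 0"
  shows "for_dense (\<lambda>n S. K * real (card {y\<in>S. \<not> robust N S D c y}) \<le> real (card S))"
proof -
  obtain j0 where j0: "j0 \<notin> D" using D(1) by (metis ex_new_if_finite infinite_UNIV_nat)
  show ?thesis
  proof (rule few_not_robust[OF D(1,2) j0 K], rule rep_zero_dense)
    have "sum (c(j0 := - sum c D)) D = sum c D" using j0 by (intro sum.cong) auto
    thus "sum (c(j0 := - sum c D)) (insert j0 D) = 0" using D j0 by simp
  qed (use D j0 in auto)
qed

text \<open>Columns of parts with coefficient sum zero are attached to the part \<open>rs\<close>,
  whose sum they do not change. Every remaining group then has a nonzero sum, so that robustness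
  applies to it.\<close>

lemma rep_expand:
  fixes c :: "nat \<Rightarrow> 'a::field"
  assumes fin: "finite C" "finite I" "finite F" and p: "\<And>j. j \<in> C \<Longrightarrow> p j \<in> I"
    and z: "inj_on z I" "z ` I \<inter> F = {}"
    and rs: "rs \<in> I" "sum c {j\<in>C. p j = rs} \<noteq> 0"
    and rob: "\<And>D r. D \<subseteq> C \<Longrightarrow> D \<noteq> {} \<Longrightarrow> sum c D \<noteq> 0 \<Longrightarrow> r \<in> I \<Longrightarrow> robust N S D c (z r)"
    and N: "card F + card I + card C \<le> N"
  shows "rep (S - F) C c (\<lambda>t. \<Sum>r\<in>I. sum c {j\<in>C. p j = r} * z r t)"
proof -
  define e where "e = (\<lambda>r. sum c {j\<in>C. p j = r})"
  define R where "R = {r\<in>I. e r \<noteq> 0}"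
  define p' where "p' = (\<lambda>j. if e (p j) \<noteq> 0 then p j else rs)"
  define D where "D = (\<lambda>r. {j\<in>C. p' j = r})"
  have p': "p' ` C \<subseteq> R" using p rs by (auto simp: p'_def R_def e_def)
  have finR: "finite R" using fin by (simp add: R_def)
  have sumD: "sum c (D r) = e r" if r: "r \<in> R" for r
  proof (cases "r = rs")
    case False
    have "D r = {j\<in>C. p j = r}" using False r by (auto simp: D_def p'_def R_def)
    thus ?thesis by (simp add: e_def)
  next
    case True
    define Z where "Z = {j\<in>C. e (p j) = 0}"
    have "sum c Z = (\<Sum>r\<in>{r\<in>I. e r = 0}. sum c {j\<in>Z. p j = r})"
      using fin p by (intro sum.group[symmetric]) (auto simp: Z_def)
    also have "\<dots> = (\<Sum>r\<in>{r\<in>I. e r = 0}. e r)"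
    proof (rule sum.cong[OF refl])
      fix r assume "r \<in> {r\<in>I. e r = 0}"
      hence "{j\<in>Z. p j = r} = {j\<in>C. p j = r}" by (auto simp: Z_def)
      thus "sum c {j\<in>Z. p j = r} = e r" by (simp add: e_def)
    qed
    finally have "sum c Z = 0" by simp
    moreover have "D r = {j\<in>C. p j = rs} \<union> Z" "{j\<in>C. p j = rs} \<inter> Z = {}"
      using True rs by (auto simp: D_def p'_def Z_def e_def split: if_splits)
    ultimately show ?thesis using fin True by (simp add: sum.union_disjoint e_def Z_def)
  qed
  have C: "C = (\<Union>r\<in>R. D r)" using p' by (auto simp: D_def)
  have "\<exists>x. (\<forall>r\<in>R. \<forall>j\<in>D r. x j \<in> S - F) \<and> inj_on x (\<Union>r\<in>R. D r) \<and>
      (\<forall>r\<in>R. \<forall>t. (\<Sum>j\<in>D r. c j * x j t) = e r * z r t)"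
  \<comment> \<open>All \<open>z r\<close> are reserved, because a group with a single column has no
    other choice than \<open>z r\<close>.\<close>
  proof (rule rep_family[where N = N and G = UNIV and z = z])
    show "rep (S - F') (D r) c (\<lambda>t. e r * z r t)" if "r \<in> R" "finite F'" "card F' \<le> N" "r \<in> UNIV \<Longrightarrow> z r \<notin> F'" for r F'
    proof -
      have "e r \<noteq> 0" "r \<in> I" using that by (auto simp: R_def)
      moreover have "D r \<noteq> {}" using sumD[OF that(1)] \<open>e r \<noteq> 0\<close> by auto
      moreover have "D r \<subseteq> C" by (auto simp: D_def)
      ultimately have "robust N S (D r) c (z r)" using rob sumD[OF that(1)] by simp
      thus ?thesis using that sumD[OF that(1)] unfolding robust_def by simp
    qed
    show "inj_on z (UNIV \<inter> R)" using z(1) by (rule inj_on_subset) (auto simp: R_def)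
    show "z ` (UNIV \<inter> R) \<inter> F = {}" using z(2) by (auto simp: R_def)
    have "card R \<le> card I" using fin by (intro card_mono) (auto simp: R_def)
    thus "card F + card (UNIV \<inter> R) + card (\<Union>r\<in>R. D r) \<le> N" using N C by simp
  qed (use fin finR in \<open>auto simp: D_def\<close>)
  then obtain x where x: "\<And>r j. r \<in> R \<Longrightarrow> j \<in> D r \<Longrightarrow> x j \<in> S - F" "inj_on x C"
    "\<And>r t. r \<in> R \<Longrightarrow> (\<Sum>j\<in>D r. c j * x j t) = e r * z r t" unfolding C[symmetric] by blast
  have "(\<Sum>j\<in>C. c j * x j t) = (\<Sum>r\<in>I. e r * z r t)" for t
  proof -
    have "(\<Sum>j\<in>C. c j * x j t) = (\<Sum>r\<in>R. \<Sum>j\<in>D r. c j * x j t)"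
      unfolding D_def using fin finR p' by (intro sum.group[symmetric]) auto
    also have "\<dots> = (\<Sum>r\<in>R. e r * z r t)" using x(3) by simp
    also have "\<dots> = (\<Sum>r\<in>I. e r * z r t)"
      using fin by (intro sum.mono_neutral_left) (auto simp: R_def)
    finally show ?thesis .
  qed
  moreover have "\<forall>j\<in>C. x j \<in> S - F" using x(1) C by blast
  ultimately show ?thesis using x(2) unfolding rep_def e_def by blast
qed

subsection \<open>Column classes\<close>

lemma col_equiv_refl: "col_equiv m A j j"
  unfolding col_equiv_def by (intro exI[of _ 1]) simp

lemma col_equiv_sym: "col_equiv m A j j' \<Longrightarrow> col_equiv m A j' j"
  unfolding col_equiv_def
proof (elim exE conjE)
  fix c assume "c \<noteq> 0" "\<forall>i<m. A i j = c * A i j'"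
  thus "\<exists>c. c \<noteq> 0 \<and> (\<forall>i<m. A i j' = c * A i j)" by (intro exI[of _ "inverse c"]) simp
qed

lemma col_equiv_trans: "col_equiv m A j j' \<Longrightarrow> col_equiv m A j' j'' \<Longrightarrow> col_equiv m A j j''"
  unfolding col_equiv_def
proof (elim exE conjE)
  fix c d assume "c \<noteq> 0" "\<forall>i<m. A i j = c * A i j'" "d \<noteq> 0" "\<forall>i<m. A i j' = d * A i j''"
  thus "\<exists>c. c \<noteq> 0 \<and> (\<forall>i<m. A i j = c * A i j'')" by (intro exI[of _ "c * d"]) simp
qed

lemma col_class_eq: "j' \<in> col_class m k A j \<Longrightarrow> col_class m k A j' = col_class m k A j"
  unfolding col_class_def using col_equiv_sym col_equiv_trans by blast

lemma col_classes_disjoint: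
  assumes "C \<in> col_classes m k A" "C' \<in> col_classes m k A" "C \<noteq> C'"
  shows "C \<inter> C' = {}"
  using assms col_class_eq unfolding col_classes_def by blast

lemma Union_col_classes: "\<Union>(col_classes m k A) = {..<k}"
  unfolding col_classes_def col_class_def using col_equiv_refl by auto

lemma col_class_scalars:
  obtains c a where "\<And>j. c j \<noteq> (0::'a::field)"
    "\<And>C i j. C \<in> col_classes m k A \<Longrightarrow> j \<in> C \<Longrightarrow> i < m \<Longrightarrow> A i j = c j * a C i"
proof -
  define \<rho> where "\<rho> = (\<lambda>C :: nat set. SOME j. j \<in> C)"
  have \<rho>: "col_equiv m A j (\<rho> (col_class m k A j))" if "j < k" for j
  proof -
    have "j \<in> col_class m k A j" using that col_equiv_refl by (simp add: col_class_def)
    hence "\<rho> (col_class m k A j) \<in> col_class m k A j" unfolding \<rho>_def by (rule someI)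
    thus ?thesis by (simp add: col_class_def)
  qed
  \<comment> \<open>Indices \<open>j \<ge> k\<close> also get a nonzero scalar, which spares a range
    condition on \<open>c\<close> later.\<close>
  have "\<forall>j. \<exists>c. c \<noteq> 0 \<and> (j < k \<longrightarrow> (\<forall>i<m. A i j = c * A i (\<rho> (col_class m k A j))))"
    using \<rho> unfolding col_equiv_def by (metis zero_neq_one)
  then obtain c where c: "\<And>j. c j \<noteq> 0" "\<And>j i. j < k \<Longrightarrow> i < m \<Longrightarrow> A i j = c j * A i (\<rho> (col_class m k A j))"
    by metis
  show thesis
  proof (rule that[of c "\<lambda>C i. A i (\<rho> C)"])
    fix C i j assume "C \<in> col_classes m k A" "j \<in> C" "i < m"
    moreover from this obtain l where "C = col_class m k A l" unfolding col_classes_def by blast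
    with \<open>j \<in> C\<close> have "C = col_class m k A j" "j < k"
      using col_class_eq[of j m k A l] by (auto simp: col_class_def)
    ultimately show "A i j = c j * A i (\<rho> C)" using c(2) by blast
  qed (rule c(1))
qed

section \<open>From class values to a shape\<close>

theorem theorem4p2:
  fixes A :: "nat \<Rightarrow> nat \<Rightarrow> 'a::{field,finite}"
    and m k s :: nat
    and P :: "nat \<Rightarrow> nat set"
  assumes RC: "type_RC m k A"
    and nondeg: "non_degenerate m k A"
    and irred: "irreducible_sys m k A"
    and part_cover: "(\<Union>r\<in>{1..2*s}. P r) = {..<k}"
    and part_disj: "\<forall>r\<in>{1..2*s}. \<forall>r'\<in>{1..2*s}. r \<noteq> r' \<longrightarrow> P r \<inter> P r' = {}"
    and part_nonempty: "\<forall>r\<in>{1..2*s}. P r \<noteq> {}"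
    and cond_i: "\<forall>r\<in>{1..s}. \<forall>i<m. (\<Sum>j\<in>P r \<union> P (s + r). A i j) = 0"
    and cond_ii: "\<forall>b. in_row_span m k A b \<and> (\<exists>j<k. b j \<noteq> 0) \<longrightarrow>
                    (\<exists>r1\<in>{1..s}. \<exists>r2\<in>{1..s}. r1 \<noteq> r2 \<and>
                        (\<Sum>j\<in>P r1. b j) \<noteq> 0 \<and> (\<Sum>j\<in>P r2. b j) \<noteq> 0)"
    and cond_iii: "\<forall>C\<in>col_classes m k A. card C = 2 \<and> class_sums_zero m A C \<longrightarrow>
                    (\<exists>r\<in>{1..s}. C = P r \<union> P (s + r))"
  shows "moderate m k A"
proof -
  define I where "I = {1..2*s}"
  have I: "finite I" "card I = 2 * s" by (auto simp: I_def)
  have upper: "s + r \<in> I" "r \<in> I" if "r \<in> {1..s}" for r using that by (auto simp: I_def)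
  have "\<forall>j\<in>{..<k}. \<exists>r. r \<in> I \<and> j \<in> P r" using part_cover unfolding I_def by blast
  then obtain p where p: "\<And>j. j < k \<Longrightarrow> p j \<in> I \<and> j \<in> P (p j)" by (metis lessThan_iff)
  have Pp: "P r = {j\<in>{..<k}. p j = r}" if "r \<in> I" for r
  proof -
    have "j < k" if "j \<in> P r" for j using part_cover that \<open>r \<in> I\<close> unfolding I_def by blast
    moreover have "p j = r" if "j \<in> P r" "j < k" for j
      using part_disj p[OF that(2)] that \<open>r \<in> I\<close> unfolding I_def by blast
    ultimately show ?thesis using p by auto
  qed
  have finP: "finite (P r)" if "r \<in> I" for r using Pp[OF that] by simp
  define f where "f = (\<lambda>i r. \<Sum>j\<in>P r. A i j)"
  have anti: "f i (s + r) = - f i r" if "i < m" "r \<in> {1..s}" for i r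
  proof -
    have "P r \<inter> P (s + r) = {}" using part_disj upper[OF that(2)] that(2) unfolding I_def by force
    hence "f i r + f i (s + r) = (\<Sum>j\<in>P r \<union> P (s + r). A i j)"
      using finP upper[OF that(2)] by (simp add: f_def sum.union_disjoint)
    thus ?thesis using cond_i that by (simp add: eq_neg_iff_add_eq_0 add.commute)
  qed
  have sumf: "(\<Sum>x\<in>I. f i x) = 0" if "i < m" for i
    unfolding I_def sum_atLeastAtMost_double using anti that by (intro sum.neutral) auto
  \<comment> \<open>For a nonzero combination, (ii) yields nonzero coefficients at \<open>r1\<close>
    and \<open>r2\<close>, and antisymmetry a third one at \<open>s + r1\<close>; two positions
    cannot cover these.\<close>
  have weight: "\<forall>i<m. w i = 0"
    if u: "\<And>x. x \<in> I \<Longrightarrow> (\<Sum>i<m. w i * f i x) = (if x = r then a else 0) + (if x = r' then b else 0)"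
    for w a b r r'
  proof -
    define d where "d = (\<lambda>j. \<Sum>i<m. w i * A i j)"
    have ud: "(\<Sum>j\<in>P x. d j) = (\<Sum>i<m. w i * f i x)" for x
      unfolding d_def f_def by (subst sum.swap) (simp add: sum_distrib_left)
    have "d j = 0" if "j < k" for j
    proof (rule ccontr)
      assume "d j \<noteq> 0"
      moreover have "in_row_span m k A d" unfolding in_row_span_def d_def by blast
      ultimately obtain r1 r2 where r12: "r1 \<in> {1..s}" "r2 \<in> {1..s}" "r1 \<noteq> r2"
        "(\<Sum>i<m. w i * f i r1) \<noteq> 0" "(\<Sum>i<m. w i * f i r2) \<noteq> 0"
        using cond_ii \<open>j < k\<close> unfolding ud[symmetric] by blast
      have "(\<Sum>i<m. w i * f i (s + r1)) = - (\<Sum>i<m. w i * f i r1)"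
        using anti r12(1) by (simp add: sum_negf[symmetric])
      hence "(\<Sum>i<m. w i * f i (s + r1)) \<noteq> 0" using r12(4) by simp
      hence "s + r1 \<in> {r, r'}" "r1 \<in> {r, r'}" "r2 \<in> {r, r'}"
        using u[of "s + r1"] u[of r1] u[of r2] upper[OF r12(1)] upper[OF r12(2)] r12(4,5)
        by (auto split: if_splits)
      moreover have "s + r1 \<noteq> r1" "s + r1 \<noteq> r2" using r12 by auto
      ultimately show False using r12(3) by auto
    qed
    thus ?thesis using nondeg unfolding non_degenerate_def d_def by blast
  qed

  define CL where "CL = col_classes m k A"
  have CL: "\<Union>CL = {..<k}" "\<And>C C'. C \<in> CL \<Longrightarrow> C' \<in> CL \<Longrightarrow> C \<noteq> C' \<Longrightarrow> C \<inter> C' = {}"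
    unfolding CL_def by (rule Union_col_classes) (rule col_classes_disjoint)
  have finCL: "finite CL" unfolding CL_def col_classes_def by simp
  have C: "C \<subseteq> {..<k}" "finite C" "card C \<le> k" "C \<noteq> {}" if "C \<in> CL" for C
  proof -
    show *: "C \<subseteq> {..<k}" using CL(1) that by blast
    thus "finite C" using finite_subset by blast
    show "card C \<le> k" using card_mono[OF _ *] by simp
    show "C \<noteq> {}" using that col_equiv_refl unfolding CL_def col_classes_def col_class_def by blast
  qed
  obtain c a where c: "\<And>j. c j \<noteq> 0" and ca: "\<And>C i j. C \<in> CL \<Longrightarrow> j \<in> C \<Longrightarrow> i < m \<Longrightarrow> A i j = c j * a C i"
    unfolding CL_def using col_class_scalars[of m k A] by metis
  define e where "e = (\<lambda>C r. sum c {j\<in>C. p j = r})"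
  have sume: "(\<Sum>r\<in>I. e C r * g r) = (\<Sum>j\<in>C. c j * g (p j))" if "C \<in> CL" for C g
  proof -
    have "(\<Sum>r\<in>I. e C r * g r) = (\<Sum>r\<in>I. \<Sum>j\<in>{j\<in>C. p j = r}. c j * g (p j))"
      by (simp add: e_def sum_distrib_right)
    also have "\<dots> = (\<Sum>j\<in>C. c j * g (p j))"
      using C[OF that] p I by (intro sum.group) auto
    finally show ?thesis .
  qed
  \<comment> \<open>The negation of \<open>dep C\<close> is what \<open>generic_solution\<close>
    demands of the members of \<open>E\<close>.\<close>
  define dep where "dep = (\<lambda>C. \<exists>w b r. r \<in> I \<and> (\<forall>x\<in>I. e C x = (\<Sum>i<m. w i * f i x) + (if x = r then b else 0)))"
  define E where "E = e ` {C\<in>CL. \<not> dep C}"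
  \<comment> \<open>\<open>Suc k\<close> forbidden vectors, \<open>2 * s\<close> reserved vectors
    \<open>z r\<close> and at most \<open>k\<close> columns, as \<open>rep_expand\<close>
    requires.\<close>
  define N where "N = 2 * k + 2 * s + 1"
  define DD where "DD = {D \<in> Pow {..<k}. D \<noteq> {} \<and> sum c D \<noteq> 0}"
  \<comment> \<open>\<open>Suc k\<close> is the budget for all classes together: \<open>k\<close>
    columns and one vector reserved for a class of size 1.\<close>
  define Q1 where "Q1 = (\<lambda>(n::nat) S. \<exists>y\<in>sols f m I S. inj_on y I \<and>
     (\<forall>e\<in>E. \<forall>F. finite F \<and> card F \<le> Suc k \<longrightarrow>
       (\<exists>z\<in>sols f m I S. inj_on z I \<and> z ` I \<inter> F = {} \<and>
         (\<forall>t. (\<Sum>r\<in>I. e r * z r t) = (\<Sum>r\<in>I. e r * y r t)))))"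
  have Q1: "for_dense Q1"
    unfolding Q1_def I_def
  proof (rule generic_solution)
    show "finite E" using finCL by (simp add: E_def)
    show "\<not> (\<forall>x\<in>{1..2*s}. e' x = (\<Sum>i<m. w i * f i x) + (if x = r then b else 0))"
      if "e' \<in> E" "r \<in> {1..2*s}" for e' w b r
      using that unfolding E_def dep_def I_def by blast
    show "\<forall>i<m. w i = 0" if "r \<in> {1..2*s}" "r' \<in> {1..2*s}"
      "\<And>x. x \<in> {1..2*s} \<Longrightarrow> (\<Sum>i<m. w i * f i x) = (if x = r then a else 0) + (if x = r' then b else 0)" for w a b r r'
      by (rule weight[of w r a r' b]) (use that(3) in \<open>simp add: I_def\<close>)
  qed (rule anti)
  \<comment> \<open>\<open>DD\<close> has at most \<open>2 ^ k\<close> members, so the factor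
    \<open>2 * 2 ^ k\<close> leaves at least half of \<open>S\<close> robust for all of them. The
    bound \<open>2 * Suc k \<le> card S\<close> lets half of \<open>S\<close> survive the removal of
    \<open>Suc k\<close> vectors.\<close>
  have "for_dense (\<lambda>n S. (\<forall>T\<subseteq>S. real (card S) \<le> 2 * real (card T) \<longrightarrow> Q1 n T) \<and>
     (\<forall>D\<in>DD. 2 * 2 ^ k * real (card {y\<in>S. \<not> robust N S D c y}) \<le> real (card S)) \<and>
     (\<forall>C\<in>{C\<in>CL. card C \<ge> 3 \<and> sum c C = 0}. \<forall>T\<subseteq>S. real (card S) \<le> 2 * real (card T) \<longrightarrow> rep T C c (\<lambda>_. 0)) \<and>
     2 * Suc k \<le> card S)"
  proof (intro for_dense_conj for_dense_ball for_dense_subset Q1 for_dense_card)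
    show "for_dense (\<lambda>n S. 2 * 2 ^ k * real (card {y\<in>S. \<not> robust N S D c y}) \<le> real (card S))" if "D \<in> DD" for D
      using that c by (intro few_not_robust_dense) (auto simp: DD_def intro: finite_subset)
    show "for_dense (\<lambda>n S. rep S C' c (\<lambda>_. 0))" if "C' \<in> {C\<in>CL. card C \<ge> 3 \<and> sum c C = 0}" for C'
      using that c C(2) by (intro rep_zero_dense) auto
  qed (use finCL in \<open>auto simp: DD_def\<close>)
  hence "for_dense (\<lambda>n S. \<exists>x. (\<forall>j<k. x j \<in> S) \<and> is_shape m k A x)"
  proof (rule for_dense_mono, elim conjE)
    fix n and S :: "(nat \<Rightarrow> 'a) set"
    assume S: "S \<subseteq> vecs n"
      and H1: "\<forall>T\<subseteq>S. real (card S) \<le> 2 * real (card T) \<longrightarrow> Q1 n T"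
      and H2: "\<forall>D\<in>DD. 2 * 2 ^ k * real (card {y\<in>S. \<not> robust N S D c y}) \<le> real (card S)"
      and H3: "\<forall>C\<in>{C\<in>CL. card C \<ge> 3 \<and> sum c C = 0}. \<forall>T\<subseteq>S. real (card S) \<le> 2 * real (card T) \<longrightarrow> rep T C c (\<lambda>_. 0)"
      and H4: "2 * Suc k \<le> card S"
    have finS: "finite S" using S finite_vecs finite_subset by blast
    define T where "T = {y\<in>S. \<forall>D\<in>DD. robust N S D c y}"
    have finDD: "finite DD" by (simp add: DD_def)
    have "real (card S) \<le> 2 * real (card T)"
    proof -
      define B where "B = (\<lambda>D. {y\<in>S. \<not> robust N S D c y})"
      have "S \<subseteq> T \<union> (\<Union>D\<in>DD. B D)" by (auto simp: T_def B_def)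
      moreover have "finite (T \<union> (\<Union>D\<in>DD. B D))" using finS finDD by (simp add: T_def B_def)
      ultimately have "card S \<le> card (T \<union> (\<Union>D\<in>DD. B D))" by (intro card_mono)
      also have "\<dots> \<le> card T + (\<Sum>D\<in>DD. card (B D))"
        using card_Un_le[of T "\<Union>D\<in>DD. B D"] card_UN_le[OF finDD, of B] by linarith
      finally have "real (card S) \<le> real (card T) + (\<Sum>D\<in>DD. real (card (B D)))"
        by (simp only: of_nat_sum[symmetric] of_nat_add[symmetric] of_nat_le_iff)
      also have "(\<Sum>D\<in>DD. real (card (B D))) \<le> real (card DD) * (real (card S) / (2 * 2 ^ k))"
        using H2 by (intro sum_bounded_above) (auto simp: B_def field_simps)
      also have "\<dots> \<le> 2 ^ k * (real (card S) / (2 * 2 ^ k))"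
      proof (intro mult_right_mono)
        have "card DD \<le> card (Pow {..<k})" by (intro card_mono) (auto simp: DD_def)
        hence "card DD \<le> 2 ^ k" by (simp add: card_Pow)
        hence "real (card DD) \<le> real (2 ^ k)" by (simp only: of_nat_le_iff)
        thus "real (card DD) \<le> 2 ^ k" by simp
      qed auto
      finally show ?thesis by simp
    qed
    hence "Q1 n T" using H1 by (auto simp: T_def)
    then obtain y where y: "y \<in> sols f m I T" "inj_on y I"
      and pop: "\<forall>e\<in>E. \<forall>F. finite F \<and> card F \<le> Suc k \<longrightarrow>
        (\<exists>z\<in>sols f m I T. inj_on z I \<and> z ` I \<inter> F = {} \<and>
          (\<forall>t. (\<Sum>r\<in>I. e r * z r t) = (\<Sum>r\<in>I. e r * y r t)))"
      unfolding Q1_def by (elim bexE conjE)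
    have yT: "y r \<in> T" if "r \<in> I" for r using y(1) that unfolding sols_def by blast
    have yeq: "(\<Sum>r\<in>I. f i r * y r t) = 0" if "i < m" for i t using y(1) that unfolding sols_def by blast
    define v where "v = (\<lambda>C t. \<Sum>j\<in>C. c j * y (p j) t)"
    define G where "G = {C :: nat set. card C = 1}"
    \<comment> \<open>For \<open>C \<in> G\<close>, \<open>Min C\<close> is the only column of
      \<open>C\<close>.\<close>
    define \<zeta> where "\<zeta> = (\<lambda>C. y (p (Min C)))"
    have local: "rep (S - F) C c (v C)"
      if C': "C \<in> CL" and F: "finite F" "card F \<le> Suc k" and guard: "C \<in> G \<Longrightarrow> \<zeta> C \<notin> F" for C F
    proof (cases "C \<in> G")
      case True
      then obtain j where j: "C = {j}" unfolding G_def using card_1_singletonE by blast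
      have "y (p j) \<in> S - F" using guard[OF True] yT p C(1)[OF C'] j by (auto simp: \<zeta>_def T_def)
      thus ?thesis unfolding rep_def v_def j by (intro exI[of _ "\<lambda>_. y (p j)"]) simp
    next
      case False
      note finC = C(2)[OF C']
      have cardC: "card C \<ge> 2"
        using False C(4)[OF C'] finC unfolding G_def
        by (metis (mono_tags, lifting) One_nat_def Suc_1 Suc_leI card_gt_0_iff le_neq_implies_less mem_Collect_eq)
      have pC: "p j \<in> I" if "j \<in> C" for j using that p C(1)[OF C'] by blast
      have vC: "v C = (\<lambda>t. \<Sum>r\<in>I. e C r * y r t)"
        unfolding v_def using sume[OF C', of "\<lambda>r. y r _"] by (intro ext) simp
      show ?thesis
      proof (cases "dep C")
        case False
        hence "e C \<in> E" using C' by (auto simp: E_def)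
        from bspec[OF pop this, rule_format, OF conjI[OF F]] obtain z where z: "z \<in> sols f m I T" "inj_on z I" "z ` I \<inter> F = {}"
          "\<And>t. (\<Sum>r\<in>I. e C r * z r t) = (\<Sum>r\<in>I. e C r * y r t)" by blast
        have "\<exists>rs\<in>I. e C rs \<noteq> 0"
        proof (rule ccontr)
          assume none: "\<not> ?thesis"
          obtain j where "j \<in> C" using C(4)[OF C'] by blast
          hence "dep C" unfolding dep_def using pC none
            by (intro exI[of _ "\<lambda>_. 0"] exI[of _ 0] exI[of _ "p j"]) auto
          thus False using False by simp
        qed
        then obtain rs where rs: "rs \<in> I" "e C rs \<noteq> 0" by blast
        have "rep (S - F) C c (\<lambda>t. \<Sum>r\<in>I. sum c {j\<in>C. p j = r} * z r t)"
        proof (rule rep_expand[OF finC I(1) F(1) pC z(2,3) rs(1)])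
          show "sum c {j\<in>C. p j = rs} \<noteq> 0" using rs(2) by (simp add: e_def)
          show "robust N S D c (z r)" if "D \<subseteq> C" "D \<noteq> {}" "sum c D \<noteq> 0" "r \<in> I" for D r
          proof -
            have "z r \<in> T" using z(1) that(4) unfolding sols_def by blast
            moreover have "D \<in> DD" using that C(1)[OF C'] by (auto simp: DD_def)
            ultimately show ?thesis by (simp add: T_def)
          qed
          show "card F + card I + card C \<le> N" using F(2) I(2) C(3)[OF C'] by (simp add: N_def)
        qed
        thus ?thesis unfolding vC using z(4) by (simp add: e_def)
      next
        case True
        then obtain w b r where r: "r \<in> I" and w: "\<And>x. x \<in> I \<Longrightarrow> e C x = (\<Sum>i<m. w i * f i x) + (if x = r then b else 0)"
          unfolding dep_def by blast
        have comb: "(\<Sum>x\<in>I. e C x * g x) = (\<Sum>i<m. w i * (\<Sum>x\<in>I. f i x * g x)) + b * g r" for g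
        proof -
          have "(\<Sum>x\<in>I. e C x * g x) = (\<Sum>x\<in>I. (\<Sum>i<m. w i * f i x) * g x) + (\<Sum>x\<in>I. (if x = r then b else 0) * g x)"
            by (simp add: w distrib_right sum.distrib)
          also have "(\<Sum>x\<in>I. (\<Sum>i<m. w i * f i x) * g x) = (\<Sum>i<m. w i * (\<Sum>x\<in>I. f i x * g x))"
            by (simp add: sum_distrib_left sum_distrib_right mult.assoc) (rule sum.swap)
          finally show ?thesis using sum_delta_mult[OF I(1) r, of b g] by simp
        qed
        \<comment> \<open>The combination of rows vanishes on constants, since the coefficients
          \<open>f i x\<close> add up to zero, and on \<open>y\<close>, since \<open>y\<close> is a
          solution. So the same \<open>b\<close> is both the sum of the scalars in \<open>C\<close>
          and the multiplier in \<open>v C\<close>.\<close>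
        have sumC: "sum c C = b"
          using comb[of "\<lambda>_. 1"] sume[OF C', of "\<lambda>_. 1"] sumf by simp
        have vb: "v C = (\<lambda>t. b * y r t)"
        proof
          fix t show "v C t = b * y r t" unfolding vC using comb[of "\<lambda>x. y x t"] yeq by simp
        qed
        show ?thesis
        proof (cases "b = 0")
          case False
          hence "C \<in> DD" using sumC C(1,4)[OF C'] by (auto simp: DD_def)
          hence "robust N S C c (y r)" using yT[OF r] by (simp add: T_def)
          moreover have "card F \<le> N" using F(2) by (simp add: N_def)
          ultimately show ?thesis using F(1) cardC unfolding vb robust_def sumC by auto
        next
          case True
          \<comment> \<open>By (iii) the two columns would be the only members of
            \<open>P r0\<close> and \<open>P (s + r0)\<close>. Then \<open>e C\<close>, a
            combination of the rows of \<open>f\<close>, has just two nonzero coefficients, which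
            \<open>weight\<close> forbids.\<close>
          have "card C \<noteq> 2"
          proof
            assume two: "card C = 2"
            have "(\<Sum>j\<in>C. A i j) = 0" if "i < m" for i
              using ca[OF C' _ that] sumC True by (simp add: sum_distrib_right[symmetric])
            hence "class_sums_zero m A C" by (simp add: class_sums_zero_def)
            then obtain r0 where r0: "r0 \<in> {1..s}" "C = P r0 \<union> P (s + r0)"
              using cond_iii two C' unfolding CL_def by blast
            note up = upper[OF r0(1)]
            have disj: "P r0 \<inter> P (s + r0) = {}" using part_disj up r0(1) unfolding I_def by force
            hence "card (P r0) + card (P (s + r0)) = 2"
              using two finP up by (simp add: r0(2) card_Un_disjoint)
            moreover have "card (P r0) \<noteq> 0" "card (P (s + r0)) \<noteq> 0"
              using part_nonempty finP up unfolding I_def by auto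
            ultimately have "card (P r0) = 1" by linarith
            then obtain j0 where j0: "P r0 = {j0}" by (elim card_1_singletonE)
            have sub: "{j\<in>C. p j = x} = C \<inter> P x" if "x \<in> I" for x
              using Pp[OF that] C(1)[OF C'] by auto
            have "C \<inter> P r0 = {j0}" using r0(2) j0 by auto
            hence e0: "e C r0 = c j0" using sub[OF up(2)] by (simp add: e_def)
            have "e C x = 0" if "x \<in> I" "x \<noteq> r0" "x \<noteq> s + r0" for x
            proof -
              have "C \<inter> P x = {}" using part_disj that up unfolding r0(2) I_def by blast
              hence "{j\<in>C. p j = x} = {}" unfolding sub[OF that(1)] .
              thus ?thesis unfolding e_def by (simp only: sum.empty)
            qed
            moreover have "r0 \<noteq> s + r0" using r0(1) by auto
            ultimately have "(\<Sum>i<m. w i * f i x) = (if x = r0 then e C r0 else 0) + (if x = s + r0 then e C (s + r0) else 0)"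
              if "x \<in> I" for x using w[OF that] True that by auto
            hence "\<forall>i<m. w i = 0" by (rule weight)
            hence "e C r0 = 0" using w[OF up(2)] True by simp
            thus False using e0 c by simp
          qed
          hence "C \<in> {C\<in>CL. card C \<ge> 3 \<and> sum c C = 0}" using cardC sumC True C' by simp
          moreover have "real (card S) \<le> 2 * real (card (S - F))"
          proof -
            have "card S \<le> card (S - F) + card F" using card_Un_le[of "S - F" F] F(1) finS card_mono[of "S - F \<union> F" S] by fastforce
            moreover have "2 * card F \<le> card S" using mult_le_mono2[OF F(2), of 2] H4 by (rule le_trans)
            ultimately have "card S \<le> 2 * card (S - F)" by linarith
            hence "real (card S) \<le> real (2 * card (S - F))" by (simp only: of_nat_le_iff)
            thus ?thesis by simp
          qed
          ultimately have "rep (S - F) C c (\<lambda>_. 0)" using H3 by blast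
          thus ?thesis unfolding vb True by simp
        qed
      qed
    qed
    have G1: "card (G \<inter> CL) \<le> 1"
    proof -
      have "G \<inter> CL = {C \<in> col_classes m k A. card C = 1}" by (auto simp: G_def CL_def)
      thus ?thesis using RC unfolding type_RC_def by simp
    qed
    have "\<exists>x. (\<forall>C\<in>CL. \<forall>j\<in>C. x j \<in> S - {}) \<and> inj_on x (\<Union>C\<in>CL. C) \<and>
           (\<forall>C\<in>CL. \<forall>t. (\<Sum>j\<in>C. c j * x j t) = v C t)"
    proof (rule rep_family[where N = "Suc k" and G = G and z = \<zeta>])
      \<comment> \<open>Type (RC) makes this automatic; two classes of size 1 in the same part would
        demand the same vector.\<close>
      show "inj_on \<zeta> (G \<inter> CL)"
        using G1 finCL by (auto simp: card_le_Suc0_iff_eq inj_on_def)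
      show "card {} + card (G \<inter> CL) + card (\<Union>C\<in>CL. C) \<le> Suc k" using G1 CL(1) by simp
    qed (use local finCL C(2) CL(2) in auto)
    then obtain x where xS: "\<forall>C\<in>CL. \<forall>j\<in>C. x j \<in> S - {}" and inj: "inj_on x (\<Union>C\<in>CL. C)"
      and xv: "\<forall>C\<in>CL. \<forall>t. (\<Sum>j\<in>C. c j * x j t) = v C t" by (elim exE conjE)
    have split: "(\<Sum>j<k. g j) = (\<Sum>C\<in>CL. \<Sum>j\<in>C. g j)" for g :: "nat \<Rightarrow> 'a"
      using sum.Union_disjoint[of CL g] C(2) CL by simp
    \<comment> \<open>The vectors \<open>x j\<close> and \<open>y (p j)\<close> give the same class
      values, hence the same row sums; for the latter, grouping the columns by parts gives the
      system with coefficients \<open>f\<close>.\<close>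
    have "(\<Sum>j<k. A i j * x j t) = 0" if "i < m" for i t
    proof -
      have "(\<Sum>j<k. A i j * x j t) = (\<Sum>C\<in>CL. a C i * (\<Sum>j\<in>C. c j * x j t))"
        unfolding split sum_distrib_left using that by (intro sum.cong refl) (simp add: ca mult_ac)
      also have "\<dots> = (\<Sum>C\<in>CL. a C i * (\<Sum>j\<in>C. c j * y (p j) t))"
        using xv by (simp add: v_def)
      also have "\<dots> = (\<Sum>j<k. A i j * y (p j) t)"
        unfolding split sum_distrib_left using that by (intro sum.cong refl) (simp add: ca mult_ac)
      also have "\<dots> = (\<Sum>r\<in>I. \<Sum>j\<in>{j\<in>{..<k}. p j = r}. A i j * y (p j) t)"
        using I p by (intro sum.group[symmetric]) auto
      also have "\<dots> = (\<Sum>r\<in>I. f i r * y r t)"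
        by (intro sum.cong refl) (simp add: f_def Pp sum_distrib_right)
      finally show ?thesis using yeq that by simp
    qed
    hence "is_solution m k A x" unfolding is_solution_def by blast
    moreover have "\<forall>j<k. x j \<in> S" using xS CL(1) by blast
    moreover have "inj_on x {..<k}" using inj CL(1) by simp
    ultimately show "\<exists>x. (\<forall>j<k. x j \<in> S) \<and> is_shape m k A x"
      unfolding is_shape_def by blast
  qed
  thus ?thesis unfolding moderate_def for_dense_def by (simp only: imp_conjL)
qed

end
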